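(* Let $N$ be a positive integer and $D$ a positive divisor of $N$. Then, with all groups regarded as subgroups of $SL_2(\mathbb{R})$ (via pre-images): (i) $SAut^+(L(N,D))$ is the group $\Gamma_0^{*,\sigma}(N)$, where $\sigma=\gcd\{D,\frac{2N}{D}\}/2^\theta$, with $\theta=1$ if $2v_2(D)=v_2(N)+1$ and $\theta=0$ otherwise. (ii) The stabilizer in $SAut^+(L(N,D))$ of the subgroup $\Delta(N,D)_H$ of $\Delta(N,D)$, or equivalently of its orthogonal complement $\Delta(N,D)_E\oplus\Delta(N,D)_F$, is precisely $\Gamma_0^*(N)$. (iii) The subgroup of $SAut^+(L(N,D))$ that fixes all the elements of $\Delta(N,D)_H$ pointwise is the subgroup of $\Gamma_0^*(N)$, containing $\Gamma_0(N)$, consisting of those elements whose associated exact divisor $\mu$ of $N$ is co-prime to $\frac{N}{D}$. (iv) The group of elements of $SAut^+(L(N,D))$ whose action leaves all three subgroups $\Delta(N,D)_H$, $\Delta(N,D)_E$, $\Delta(N,D)_F$ invariant is the group of those elements of $\Gamma_0^*(N)$ whose associated exact divisor $\mu$ is co-prime to $D$. (v) The discriminant kernel of $L(N,D)$ is the subgroup of $\Gamma_0(N)$ consisting of those matrices whose diagonal entries, reduced modulo $N$, lie in the group of those elements of $(\mathbb{Z}/N\mathbb{Z})^\times$ whose square becomes trivial in $(\mathbb{Z}/D\mathbb{Z})^\times$.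
   Context: For a positive integer $M$, write uniquely $M=s_M^2t_M$ with $s_M,t_M$ positive integers and $t_M$ square-free; $v_p(M)$ is the $p$-adic valuation of $M$. A positive divisor $\mu$ of $N$ is exact if $\gcd(\mu,N/\mu)=1$. $\Gamma_0^{*,s_N}(N)$ is the set of $A\in SL_2(\mathbb{R})$ admitting a presentation $A=\begin{pmatrix} a\sqrt{\mu} & b/\sqrt{\mu}\\ c\frac{N}{\mu}\sqrt{\mu} & d\sqrt{\mu}\end{pmatrix}$ with $\mu$ an exact divisor of $N$, $a,d\in\frac{1}{s_\mu}\mathbb{Z}$ and $b,c\in\frac{1}{s_{N/\mu}}\mathbb{Z}$. A presentation is cancelation-free if in each of the products $ab,ac,bd,cd$ of rational numbers in lowest terms no cancelation occurs (the denominator of the product is the product of the denominators); every element of $\Gamma_0^{*,s_N}(N)$ has such a presentation. For a positive divisor $\sigma$ of $s_N$, $\Gamma_0^{*,\sigma}(N)$ is the set of $A\in\Gamma_0^{*,s_N}(N)$ such that in a cancelation-free presentation $a,b,c,d\in\frac{1}{\sigma}\mathbb{Z}$ (equivalently, $\sigma ab,\sigma cd\in\mathbb{Z}$ in any presentation). $\Gamma_0^*(N)=\Gamma_0^{*,1}(N)$: each of its elements has a unique presentation with $a,b,c,d\in\mathbb{Z}$, and the $\mu$ in it is called its associated exact divisor. $\Gamma_0(N)$ is the group of matrices in $SL_2(\mathbb{Z})$ with lower left entry divisible by $N$. $M_2(\mathbb{R})_0$ is the space of traceless real $2\times2$ matrices with bilinear form $(X,Y)=\mathrm{Tr}(XY)$,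 of signature $(2,1)$, with basis $E=\begin{pmatrix}0&1\\0&0\end{pmatrix}$, $H=\begin{pmatrix}1&0\\0&-1\end{pmatrix}$, $F=\begin{pmatrix}0&0\\1&0\end{pmatrix}$. $SL_2(\mathbb{R})$ acts on it by conjugation, inducing $PSL_2(\mathbb{R})\cong SO^+(M_2(\mathbb{R})_0)$, the connected component of the orthogonal group. $L(N,D)$ is the lattice spanned by $\frac{\sqrt D}{\sqrt N}E$, $\sqrt{ND}\,F$, $\frac{\sqrt N}{\sqrt D}H$. Its dual $L^*(N,D)$ (with respect to the bilinear form) is generated by $\frac{1}{\sqrt{DN}}E$, $\frac{\sqrt N}{\sqrt D}F$, $\frac{\sqrt D}{2\sqrt N}H$, and $\Delta(N,D)=L^*(N,D)/L(N,D)$ is the discriminant group. $\Delta(N,D)$ is the direct sum of the cyclic subgroups $\Delta(N,D)_H$, $\Delta(N,D)_E$, $\Delta(N,D)_F$ generated by the classes of $\frac{\sqrt D}{2\sqrt N}H$ (order $\frac{2N}{D}$), $\frac{1}{\sqrt{DN}}E$ (order $D$), $\frac{\sqrt N}{\sqrt D}F$ (order $D$), respectively. $SAut^+(L(N,D))$ denotes the group of elements of $SL_2(\mathbb{R})$ whose conjugation action maps $L(N,D)$ onto itself (the pre-image of the group of automorphisms lying in $SO^+$). The discriminant kernel is its subgroup acting trivially on $\Delta(N,D)$. *)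

theory Defs
  imports
    "HOL-Analysis.Analysis"
    "HOL-Algebra.Generated_Groups"
    "HOL-Computational_Algebra.Squarefree"
    "HOL-Number_Theory.Cong"
begin

definition mat2 :: "real \<Rightarrow> real \<Rightarrow> real \<Rightarrow> real \<Rightarrow> real^2^2" where
  "mat2 a b c d = vector [vector [a, b], vector [c, d]]"

definition SL2R :: "(real^2^2) set" where
  "SL2R = {A. det A = 1}"

definition Gamma0 :: "nat \<Rightarrow> (real^2^2) set" where
  "Gamma0 N = {mat2 (of_int a) (of_int b) (of_int c) (of_int d) | a b c d :: int.
                 a * d - b * c = 1 \<and> int N dvd c}"

definition frac_ints :: "nat \<Rightarrow> rat set" where
  "frac_ints m = {x. of_nat m * x \<in> \<int>}"

definition exact_divisor :: "nat \<Rightarrow> nat \<Rightarrow> bool" where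
  "exact_divisor \<mu> N \<longleftrightarrow> \<mu> dvd N \<and> coprime \<mu> (N div \<mu>)"

text \<open>In the decomposition $M = s_M^2 t_M$ with $t_M$ square-free, the number $s_M$ is the
  library's \<^const>\<open>square_part\<close> (see \<open>squarefree_decompose\<close>).\<close>

definition presentation ::
    "nat \<Rightarrow> real^2^2 \<Rightarrow> nat \<Rightarrow> rat \<Rightarrow> rat \<Rightarrow> rat \<Rightarrow> rat \<Rightarrow> bool" where
  "presentation N A \<mu> a b c d \<longleftrightarrow>
     exact_divisor \<mu> N \<and>
     a \<in> frac_ints (square_part \<mu>) \<and> d \<in> frac_ints (square_part \<mu>) \<and>
     b \<in> frac_ints (square_part (N div \<mu>)) \<and> c \<in> frac_ints (square_part (N div \<mu>)) \<and>
     A = mat2 (of_rat a * sqrt (real \<mu>))                             (of_rat b / sqrt (real \<mu>))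
              (of_rat c * (real N / real \<mu>) * sqrt (real \<mu>))   (of_rat d * sqrt (real \<mu>))"

definition rat_denom :: "rat \<Rightarrow> int" where
  "rat_denom x = snd (quotient_of x)"

text \<open>Since \<open>rat_denom 0 = 1\<close>, a product with a vanishing factor is cancelation-free only if
  the other factor is an integer.\<close>

definition no_cancel :: "rat \<Rightarrow> rat \<Rightarrow> bool" where
  "no_cancel x y \<longleftrightarrow> rat_denom (x * y) = rat_denom x * rat_denom y"

definition cancelation_free :: "rat \<Rightarrow> rat \<Rightarrow> rat \<Rightarrow> rat \<Rightarrow> bool" where
  "cancelation_free a b c d \<longleftrightarrow> no_cancel a b \<and> no_cancel a c \<and> no_cancel b d \<and> no_cancel c d"

text \<open>The group $\Gamma_0^{*,s_N}(N)$.\<close>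

definition Gamma0_star_full :: "nat \<Rightarrow> (real^2^2) set" where
  "Gamma0_star_full N = {A \<in> SL2R. \<exists>\<mu> a b c d. presentation N A \<mu> a b c d}"

text \<open>The group $\Gamma_0^{*,\sigma}(N)$, intended for divisors $\sigma$ of $s_N$.\<close>

definition Gamma0_star_sigma :: "nat \<Rightarrow> nat \<Rightarrow> (real^2^2) set" where
  "Gamma0_star_sigma N \<sigma> =
     {A \<in> Gamma0_star_full N. \<exists>\<mu> a b c d.
        presentation N A \<mu> a b c d \<and> cancelation_free a b c d \<and>
        a \<in> frac_ints \<sigma> \<and> b \<in> frac_ints \<sigma> \<and> c \<in> frac_ints \<sigma> \<and> d \<in> frac_ints \<sigma>}"

definition Gamma0_star :: "nat \<Rightarrow> (real^2^2) set" where
  "Gamma0_star N = Gamma0_star_sigma N 1"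

text \<open>The divisor in the unique integral presentation; meaningful for \<open>A \<in> Gamma0_star N\<close>.\<close>

definition assoc_divisor :: "nat \<Rightarrow> real^2^2 \<Rightarrow> nat" where
  "assoc_divisor N A = (THE \<mu>. \<exists>a\<in>\<int>. \<exists>b\<in>\<int>. \<exists>c\<in>\<int>. \<exists>d\<in>\<int>. presentation N A \<mu> a b c d)"

definition mat_E :: "real^2^2" where "mat_E = mat2 0 1 0 0"
definition mat_H :: "real^2^2" where "mat_H = mat2 1 0 0 (- 1)"
definition mat_F :: "real^2^2" where "mat_F = mat2 0 0 1 0"

definition bform :: "real^2^2 \<Rightarrow> real^2^2 \<Rightarrow> real" where
  "bform X Y = trace (X ** Y)"

definition lattice_L :: "nat \<Rightarrow> nat \<Rightarrow> (real^2^2) set" where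
  "lattice_L N D =
     {of_int i *\<^sub>R ((sqrt (real D) / sqrt (real N)) *\<^sub>R mat_E)
      + of_int j *\<^sub>R (sqrt (real N * real D) *\<^sub>R mat_F)
      + of_int k *\<^sub>R ((sqrt (real N) / sqrt (real D)) *\<^sub>R mat_H) | i j k :: int. True}"

definition dual_lattice :: "(real^2^2) set \<Rightarrow> (real^2^2) set" where
  "dual_lattice L = {X. trace X = 0 \<and> (\<forall>Y\<in>L. bform X Y \<in> \<int>)}"

definition add_monoid_on :: "(real^2^2) set \<Rightarrow> (real^2^2) monoid" where
  "add_monoid_on M = \<lparr>carrier = M, mult = (+), one = 0\<rparr>"

definition disc_group :: "nat \<Rightarrow> nat \<Rightarrow> (real^2^2) set monoid" where
  "disc_group N D = add_monoid_on (dual_lattice (lattice_L N D)) Mod lattice_L N D"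

definition disc_class :: "nat \<Rightarrow> nat \<Rightarrow> real^2^2 \<Rightarrow> (real^2^2) set" where
  "disc_class N D X =
     lattice_L N D #>\<^bsub>add_monoid_on (dual_lattice (lattice_L N D))\<^esub> X"

definition disc_H :: "nat \<Rightarrow> nat \<Rightarrow> (real^2^2) set set" where
  "disc_H N D = generate (disc_group N D)
     {disc_class N D ((sqrt (real D) / (2 * sqrt (real N))) *\<^sub>R mat_H)}"

definition disc_E :: "nat \<Rightarrow> nat \<Rightarrow> (real^2^2) set set" where
  "disc_E N D = generate (disc_group N D)
     {disc_class N D ((1 / sqrt (real D * real N)) *\<^sub>R mat_E)}"

definition disc_F :: "nat \<Rightarrow> nat \<Rightarrow> (real^2^2) set set" where
  "disc_F N D = generate (disc_group N D)
     {disc_class N D ((sqrt (real N) / sqrt (real D)) *\<^sub>R mat_F)}"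

definition disc_EF :: "nat \<Rightarrow> nat \<Rightarrow> (real^2^2) set set" where
  "disc_EF N D = disc_E N D <#>\<^bsub>disc_group N D\<^esub> disc_F N D"

text \<open>Orthogonality with respect to the induced pairing $\Delta \times \Delta \to \mathbb{R}/\mathbb{Z}$.\<close>

definition disc_orth :: "nat \<Rightarrow> nat \<Rightarrow> (real^2^2) set set \<Rightarrow> (real^2^2) set set" where
  "disc_orth N D S =
     {C \<in> carrier (disc_group N D). \<forall>C'\<in>S. \<forall>X\<in>C. \<forall>Y\<in>C'. bform X Y \<in> \<int>}"

definition conj_act :: "real^2^2 \<Rightarrow> real^2^2 \<Rightarrow> real^2^2" where
  "conj_act A X = A ** X ** matrix_inv A"

definition SAut_plus :: "(real^2^2) set \<Rightarrow> (real^2^2) set" where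
  "SAut_plus L = {A \<in> SL2R. conj_act A ` L = L}"

text \<open>The action on a coset $X + L$, viewed as a set of matrices, is its elementwise image;
  for \<open>A \<in> SAut_plus L\<close> this is again a coset of $L$.\<close>

definition disc_act :: "real^2^2 \<Rightarrow> (real^2^2) set \<Rightarrow> (real^2^2) set" where
  "disc_act A C = conj_act A ` C"

definition disc_stabilizer :: "nat \<Rightarrow> nat \<Rightarrow> (real^2^2) set set \<Rightarrow> (real^2^2) set" where
  "disc_stabilizer N D S = {A \<in> SAut_plus (lattice_L N D). disc_act A ` S = S}"

definition disc_fixer :: "nat \<Rightarrow> nat \<Rightarrow> (real^2^2) set set \<Rightarrow> (real^2^2) set" where
  "disc_fixer N D S = {A \<in> SAut_plus (lattice_L N D). \<forall>C\<in>S. disc_act A C = C}"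

definition disc_kernel :: "nat \<Rightarrow> nat \<Rightarrow> (real^2^2) set" where
  "disc_kernel N D = disc_fixer N D (carrier (disc_group N D))"

definition sigma_level :: "nat \<Rightarrow> nat \<Rightarrow> nat" where
  "sigma_level N D =
     (let \<theta> = (if 2 * multiplicity 2 D = multiplicity 2 N + 1 then 1 else 0)
      in gcd D (2 * N div D) div 2 ^ \<theta>)"

text \<open>The elements of $(\mathbb{Z}/N\mathbb{Z})^\times$, represented by their residues in
  $\{0,\dots,N-1\}$, whose square is trivial in $(\mathbb{Z}/D\mathbb{Z})^\times$, for $D \mid N$.\<close>

definition square_trivial_units :: "nat \<Rightarrow> nat \<Rightarrow> int set" where
  "square_trivial_units N D = {x \<in> {0..<int N}. coprime x (int N) \<and> [x\<^sup>2 = 1] (mod int D)}"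

end

theory Submission
  imports Defs
begin

text \<open>In the coordinates \<open>lv\<close> attached to the basis of $L(N,D)$, the lattice, its dual and the
  pre-images of $\Delta_H$, $\Delta_E$, $\Delta_F$ and $\Delta_E \oplus \Delta_F$ are all defined
  by integrality of fixed multiples of the three coordinates. Hence a matrix with rows $(p,q)$, $(r,s)$
  stabilizes one of them if and only if certain monomials in $p,q,r,s$ are integral. For $L(N,D)$,
  $\Delta_H$ and $\Delta_E \oplus \Delta_F$ this means \<open>level_cond N g p q r s\<close> for a suitable $g$.
  To pass from there to presentations, write $p = \alpha\sqrt{e}$, $s = \delta\sqrt{e}$,
  $q = \beta\sqrt{f/N}$, $r = \gamma\sqrt{fN}$ with $\gcd(\alpha,\delta) = \gcd(\beta,\gamma) = 1$.
  The conditions force $\sqrt{ef/N} = h/k$ in lowest terms with $k$ dividing $g$ and $k^2$ dividing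
  $N$, and $\mu$ is chosen so that its primes do not divide $qr$ and those of $N/\mu$ do not
  divide $ps$; the latter makes the presentation cancelation-free.\<close>

subsection \<open>Integrality and coprime splittings\<close>

text \<open>Write M = N/D. Conjugating H produces the coefficients 2Mpq and 2rs/D, conjugating E and
  F produces pr/M and Dqs, and the inverse matrix gives the same with p and s exchanged. So both D
  and 2M clear the denominators of pq, sq, pr/N and sr/N, hence so does g = gcd(D, 2M). The obstacle
  is that denominators in a presentation have squares dividing N, whereas g^2 is only certain to
  divide 2N. It fails to divide N exactly when v_2(D) = v_2(M) + 1, that is 2 v_2(D) = v_2(N) + 1,
  and then g/2 is the right level: this is the origin of \<theta>. Therefore the construction of a
  presentation hands out its denominator k together with k^2 | N, and the level is lowered from g
  afterwards. The factor 2 also affects the diagonal: conjugation only gives ps + qr = 2ps - 1, so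
  integrality of ps has to be recovered from that of its square. For integral presentations the
  determinant reads ad\<mu> - bc\<nu> = 1 with \<mu>\<nu> = N; this relation turns the remaining
  divisibilities by D or M into coprimality with \<mu>.\<close>

lemma Ints_int_gcd_mult:
  fixes x :: "'a::comm_ring_1"
  assumes "of_int m * x \<in> \<int>" "of_int n * x \<in> \<int>"
  shows "of_int (gcd m n) * x \<in> \<int>"
proof -
  obtain u v :: int where uv: "u * m + v * n = gcd m n"
    using bezout_int by blast
  have "of_int (gcd m n) * x = of_int u * (of_int m * x) + of_int v * (of_int n * x)"
    unfolding uv [symmetric] by (simp add: algebra_simps)
  then show ?thesis using assms by simp
qed

lemma Ints_nat_gcd_mult:
  fixes x :: "'a::comm_ring_1"
  assumes "of_nat m * x \<in> \<int>" "of_nat n * x \<in> \<int>"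
  shows "of_nat (gcd m n) * x \<in> \<int>"
  using Ints_int_gcd_mult [of "int m" x "int n"] assms
  by (metis of_int_of_nat_eq gcd_int_int_eq)

text \<open>Strips coprime multipliers off a number not known to be rational; this is how
  integrality passes from monomials to their common irrational factor.\<close>

lemma Ints_coprime_mult:
  fixes x :: "'a::comm_ring_1"
  assumes "coprime m n" "of_int m * x \<in> \<int>" "of_int n * x \<in> \<int>"
  shows "x \<in> \<int>"
  using Ints_int_gcd_mult [OF assms(2,3)] assms(1) by simp

lemma Ints_mult_dvd:
  fixes x :: "'a::comm_ring_1"
  assumes "of_nat m * x \<in> \<int>" "m dvd n"
  shows "of_nat n * x \<in> \<int>"
proof -
  obtain k where "n = m * k" using assms(2) ..
  then have "of_nat n * x = of_nat k * (of_nat m * x)" by (simp add: algebra_simps)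
  then show ?thesis using assms(1) by simp
qed

text \<open>The integers are integrally closed in the rationals. Applied to ps, of which the lattice
  only shows that 2ps and (ps)^2 are integral.\<close>

lemma square_of_Rats_Ints:
  fixes x :: real
  assumes "x \<in> \<rat>" "x\<^sup>2 \<in> \<int>"
  shows "x \<in> \<int>"
proof -
  obtain m n :: nat where mn: "n \<noteq> 0" "\<bar>x\<bar> = real m / real n" "coprime m n"
    using Rats_abs_nat_div_natE [OF assms(1)] by metis
  obtain k :: int where k: "x\<^sup>2 = of_int k" using assms(2) by (auto elim: Ints_cases)
  have "real m ^ 2 = of_int k * real n ^ 2"
    using mn k by (metis divide_eq_eq of_nat_eq_0_iff power2_abs power_divide power_eq_0_iff)
  then have "of_int (int m ^ 2) = (of_int (k * int n ^ 2) :: real)" by simp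
  then have "int m ^ 2 = k * int n ^ 2" by (simp only: of_int_eq_iff)
  then have "int n ^ 2 dvd int m ^ 2" by simp
  then have "n dvd m" by (metis int_dvd_int_iff pow_divides_pow_iff zero_less_numeral)
  then have "n = 1" using mn(3) by (metis coprime_absorb_right nat_dvd_1_iff_1)
  then have "\<bar>x\<bar> \<in> \<int>" using mn by simp
  then show ?thesis by (metis Ints_minus abs_if minus_minus)
qed

text \<open>\<mu> collects the primes of n that divide u, with their full multiplicity in n, so it
  is an exact divisor; as u and v are coprime, none of these primes divides v. The induction moves
  one common prime of n and u into \<mu> at a time and stops with \<mu> = 1 once n is coprime to
  u.\<close>

lemma coprime_split:
  fixes u v :: int
  assumes "n > 0" "coprime u v"
  shows "\<exists>\<mu> \<nu>::nat. n = \<mu> * \<nu> \<and> coprime \<mu> \<nu> \<and> coprime (int \<nu>) u \<and> coprime (int \<mu>) v"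
  using assms(1)
proof (induction n rule: less_induct)
  case (less n)
  show ?case
  proof (cases "coprime (int n) u")
    case True
    then show ?thesis by (intro exI [of _ 1] exI [of _ n]) auto
  next
    case False
    then obtain p :: int where p: "prime p" "p dvd int n" "p dvd u"
    proof -
      have "\<not> is_unit (gcd (int n) u)" "gcd (int n) u \<noteq> 0"
        using False less.prems by (auto simp: is_unit_gcd)
      then show thesis
        using prime_divisor_exists that by (metis gcd_greatest_iff)
    qed
    define P where "P = nat p"
    have P: "p = int P" "prime P" using p(1) by (auto simp: P_def prime_gt_0_int prime_nat_iff_prime)
       (use prime_gt_0_int[of p] in linarith)
    obtain m where m: "n = P * m" using p(2) P by (metis dvdE int_dvd_int_iff)
    have "P > 1" using P prime_gt_1_nat by blast
    then have "m < n" "m > 0" using m less.prems by auto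
    then obtain \<mu> \<nu> where mn: "m = \<mu> * \<nu>" "coprime \<mu> \<nu>" "coprime (int \<nu>) u" "coprime (int \<mu>) v"
      using less.IH by blast
    have "coprime p (int \<nu>)" using p(3) mn(3) by (metis coprime_commute coprime_divisors dvd_refl)
    moreover have "coprime p v" using p(3) assms(2) by (metis coprime_divisors dvd_refl)
    ultimately show ?thesis using mn m P
      by (intro exI [of _ "P * \<mu>"] exI [of _ \<nu>]) auto
  qed
qed

text \<open>The ratio p/s = ps/s^2 is rational. With \<alpha>/\<delta> its lowest terms and t =
  s/\<delta>, both \<alpha>^2 t^2 and \<delta>^2 t^2 are integral, and coprimality makes e = t^2 an
  integer. A negative t is absorbed into the signs of \<alpha> and \<delta>. The number e may still
  contain square factors.\<close>

lemma common_sqrt: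
  fixes p s :: real
  assumes "p\<^sup>2 \<in> \<int>" "s\<^sup>2 \<in> \<int>" "p * s \<in> \<int>" "p \<noteq> 0 \<or> s \<noteq> 0"
  shows "\<exists>(e::nat) (\<alpha>::int) (\<delta>::int). e > 0 \<and> coprime \<alpha> \<delta> \<and>
           p = of_int \<alpha> * sqrt (real e) \<and> s = of_int \<delta> * sqrt (real e)"
proof -
  have *: "\<exists>(e::nat) (\<alpha>::int) (\<delta>::int). e > 0 \<and> coprime \<alpha> \<delta> \<and>
           p = of_int \<alpha> * sqrt (real e) \<and> s = of_int \<delta> * sqrt (real e)"
    if h: "p\<^sup>2 \<in> \<int>" "s\<^sup>2 \<in> \<int>" "p * s \<in> \<int>" "s \<noteq> 0" for p s :: real
  proof -
    have "p / s = (p * s) / s\<^sup>2" using h(4) by (simp add: power2_eq_square)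
    then have "p / s \<in> \<rat>" using h by (metis Ints_subset_Rats Rats_divide subsetD)
    then obtain r where r: "p / s = of_rat r" by (auto elim: Rats_cases)
    obtain \<alpha> \<delta> where q: "quotient_of r = (\<alpha>, \<delta>)" by fastforce
    have cop: "coprime \<alpha> \<delta>" and pos: "\<delta> > 0"
      using quotient_of_coprime [OF q] quotient_of_denom_pos [OF q] .
    define t where "t = s / of_int \<delta>"
    have s: "s = of_int \<delta> * t" using pos by (simp add: t_def)
    have "p / s = of_int \<alpha> / of_int \<delta>"
      unfolding r quotient_of_div [OF q] by (simp add: of_rat_divide)
    then have p: "p = of_int \<alpha> * t" using h(4) pos by (simp add: t_def field_simps)
    have "t\<^sup>2 \<in> \<int>"
    proof (rule Ints_coprime_mult)
      show "coprime (\<alpha>\<^sup>2) (\<delta>\<^sup>2)" using cop by simp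
      show "of_int (\<alpha>\<^sup>2) * t\<^sup>2 \<in> \<int>" "of_int (\<delta>\<^sup>2) * t\<^sup>2 \<in> \<int>"
        using h(1,2) unfolding p s by (simp_all add: power_mult_distrib)
    qed
    then obtain k :: int where k: "t\<^sup>2 = of_int k" by (auto elim: Ints_cases)
    have "t \<noteq> 0" using s h(4) by auto
    then have "k > 0" using k by (metis of_int_0_less_iff zero_less_power2)
    then have e: "t\<^sup>2 = real (nat k)" "nat k > 0" using k by auto
    then have "sqrt (real (nat k)) = \<bar>t\<bar>" by (metis real_sqrt_abs)
    then consider "t = sqrt (real (nat k))" | "t = - sqrt (real (nat k))" by linarith
    then show ?thesis
    proof cases
      case 1
      then show ?thesis using p s cop e by metis
    next
      case 2
      then have "p = of_int (-\<alpha>) * sqrt (real (nat k))" "s = of_int (-\<delta>) * sqrt (real (nat k))"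
        using p s by auto
      moreover have "coprime (-\<alpha>) (-\<delta>)" using cop by simp
      ultimately show ?thesis using e by blast
    qed
  qed
  show ?thesis
  proof (cases "s = 0")
    case False
    then show ?thesis using * assms by blast
  next
    case True
    then have "p \<noteq> 0" using assms by blast
    then show ?thesis using * [of s p] assms by (metis coprime_commute mult.commute)
  qed
qed

section \<open>Denominators and cancelation in products of rationals\<close>

lemma rat_denom_of_int_divide:
  fixes m k :: int
  assumes "k > 0"
  shows "rat_denom (of_int m / of_int k) * gcd m k = k"
proof -
  have "quotient_of (of_int m / of_int k) = Rat.normalize (m, k)"
    by (simp add: Fract_of_int_quotient [symmetric] quotient_of_Fract)
  then show ?thesis using assms by (simp add: rat_denom_def Rat.normalize_def Let_def)
qed

text \<open>The fractions may be unreduced: coprimality of each numerator with the opposite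
  denominator gives gcd(mn, kl) = gcd(m, k) gcd(n, l), so reducing the product removes only what
  each factor already loses. A zero numerator forces the opposite denominator to be 1, in accordance
  with \<open>rat_denom 0 = 1\<close>.\<close>

lemma no_cancel_of_int_divide:
  fixes m n k l :: int
  assumes "k > 0" "l > 0" "coprime m l" "coprime n k"
  shows "no_cancel (of_int m / of_int k) (of_int n / of_int l)"
proof -
  have *: "(of_int m / of_int k) * (of_int n / of_int l) = (of_int (m * n) / of_int (k * l) :: rat)"
    by simp
  obtain m' k' where 1: "m = m' * gcd m k" "k = k' * gcd m k" "coprime m' k'"
    using gcd_coprime_exists [of m k] assms by auto
  obtain n' l' where 2: "n = n' * gcd n l" "l = l' * gcd n l" "coprime n' l'"
    using gcd_coprime_exists [of n l] assms by auto
  have "m' dvd m" "k' dvd k" "n' dvd n" "l' dvd l" using 1 2 by (metis dvd_triv_left)+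
  then have "coprime (m' * n') (k' * l')"
    using 1(3) 2(3) assms(3,4) by (auto intro: coprime_divisors)
  then have "gcd (k' * l') (m' * n') = 1"
    by (metis coprime_commute coprime_imp_gcd_eq_1)
  then have "gcd (m' * n' * (gcd m k * gcd n l)) (k' * l' * (gcd m k * gcd n l)) = gcd m k * gcd n l"
    by (simp add: gcd_mult_right abs_mult)
  moreover have "m' * n' * (gcd m k * gcd n l) = (m' * gcd m k) * (n' * gcd n l)"
    "k' * l' * (gcd m k * gcd n l) = (k' * gcd m k) * (l' * gcd n l)" by simp_all
  ultimately have g: "gcd (m * n) (k * l) = gcd m k * gcd n l"
    using 1(1,2) 2(1,2) by simp
  have "rat_denom (of_int (m * n) / of_int (k * l)) * (gcd m k * gcd n l) = k * l"
    using rat_denom_of_int_divide [of "k * l" "m * n"] assms g by simp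
  also have "\<dots> = (rat_denom (of_int m / of_int k) * gcd m k) * (rat_denom (of_int n / of_int l) * gcd n l)"
    using rat_denom_of_int_divide assms by simp
  also have "\<dots> = (rat_denom (of_int m / of_int k) * rat_denom (of_int n / of_int l)) * (gcd m k * gcd n l)"
    by simp
  finally show ?thesis using assms unfolding no_cancel_def * by simp
qed

lemma Ints_frac_ints_product:
  assumes "x \<in> frac_ints m" "y \<in> frac_ints m" "m\<^sup>2 dvd n"
  shows "of_nat n * (x * y) \<in> \<int>"
proof -
  have "of_nat (m\<^sup>2) * (x * y) = (of_nat m * x) * (of_nat m * y)"
    by (simp add: power2_eq_square)
  then have "of_nat (m\<^sup>2) * (x * y) \<in> \<int>" using assms by (metis (no_types, lifting) Ints_mult frac_ints_def mem_Collect_eq)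
  then show ?thesis using assms(3) Ints_mult_dvd by blast
qed

text \<open>A single factor \<sigma> suffices, rather than \<sigma>^2, because the actual
  denominators divide gcd(m, \<sigma>) and gcd(n, \<sigma>), two coprime divisors of
  \<sigma>.\<close>

lemma Ints_frac_ints_coprime_product:
  assumes "x \<in> frac_ints m" "x \<in> frac_ints \<sigma>" "y \<in> frac_ints n" "y \<in> frac_ints \<sigma>" "coprime m n"
  shows "of_nat \<sigma> * (x * y) \<in> \<int>"
proof -
  let ?g = "gcd m \<sigma>" and ?h = "gcd n \<sigma>"
  have "of_nat ?g * x \<in> \<int>" "of_nat ?h * y \<in> \<int>"
    using assms Ints_nat_gcd_mult unfolding frac_ints_def by auto
  moreover have "of_nat (?g * ?h) * (x * y) = (of_nat ?g * x) * (of_nat ?h * y)" by simp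
  ultimately have "of_nat (?g * ?h) * (x * y) \<in> \<int>" by (metis Ints_mult)
  moreover have "?g * ?h dvd \<sigma>"
    using assms(5) by (meson coprime_divisors divides_mult gcd_dvd1 gcd_dvd2)
  ultimately show ?thesis using Ints_mult_dvd by blast
qed

subsection \<open>Presentations\<close>

lemma mat2_nth [simp]:
  "mat2 a b c d $ 1 $ 1 = a" "mat2 a b c d $ 1 $ 2 = b"
  "mat2 a b c d $ 2 $ 1 = c" "mat2 a b c d $ 2 $ 2 = d"
  by (simp_all add: mat2_def)

lemma mat2_eta: "mat2 (A $ 1 $ 1) (A $ 1 $ 2) (A $ 2 $ 1) (A $ 2 $ 2) = A"
  by (simp add: vec_eq_iff forall_2)

lemma mat2_eq_iff [simp]:
  "mat2 a b c d = mat2 a' b' c' d' \<longleftrightarrow> a = a' \<and> b = b' \<and> c = c' \<and> d = d'"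
  by (metis mat2_nth)

lemma det_mat2 [simp]: "det (mat2 a b c d) = a * d - b * c"
  by (simp add: det_2)

lemma mat2_SL2R_iff: "mat2 a b c d \<in> SL2R \<longleftrightarrow> a * d - b * c = 1"
  by (simp add: SL2R_def)

text \<open>In a presentation with \<nu> = N/\<mu>, the conditions without g say that \<mu>a^2,
  \<mu>d^2, \<nu>b^2, \<nu>c^2 and \<mu>ad are integral; the four products multiplied by g are ab,
  db, ac and dc. The values used are g = \<sigma> for \<open>Gamma0_star_sigma\<close>, g = gcd(D,
  2M) for the full automorphism group and g = 1 for \<open>Gamma0_star\<close>.\<close>

definition level_cond :: "nat \<Rightarrow> nat \<Rightarrow> real \<Rightarrow> real \<Rightarrow> real \<Rightarrow> real \<Rightarrow> bool" where
  "level_cond N g p q r s \<longleftrightarrow> p * s - q * r = 1 \<and>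
     p\<^sup>2 \<in> \<int> \<and> s\<^sup>2 \<in> \<int> \<and> real N * q\<^sup>2 \<in> \<int> \<and> r\<^sup>2 / real N \<in> \<int> \<and> p * s \<in> \<int> \<and>
     real g * (p * q) \<in> \<int> \<and> real g * (s * q) \<in> \<int> \<and>
     real g * (p * r / real N) \<in> \<int> \<and> real g * (s * r / real N) \<in> \<int>"

text \<open>Introduction rule with possibly unreduced entries a/k, d/k, b/l, c/l. Here k^2 | \<mu>
  is the same as k | s_\<mu>, likewise for l and \<nu>, and the crosswise coprimality is what makes
  the presentation cancelation-free.\<close>

lemma Gamma0_star_sigmaI:
  fixes a b c d :: int
  assumes N: "N = \<mu> * \<nu>" "N > 0" "coprime \<mu> \<nu>"
    and k: "k\<^sup>2 dvd \<mu>" "l\<^sup>2 dvd \<nu>" "k dvd \<sigma>" "l dvd \<sigma>"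
    and cop: "coprime a (int l)" "coprime d (int l)" "coprime b (int k)" "coprime c (int k)"
    and eq: "p = of_int a / real k * sqrt (real \<mu>)" "s = of_int d / real k * sqrt (real \<mu>)"
      "q = of_int b / real l / sqrt (real \<mu>)" "r = of_int c / real l * real \<nu> * sqrt (real \<mu>)"
    and det: "p * s - q * r = 1"
  shows "mat2 p q r s \<in> Gamma0_star_sigma N \<sigma>"
proof -
  have pos: "\<mu> > 0" "\<nu> > 0" using N by auto
  then have kl: "k > 0" "l > 0" using k by (auto intro!: Nat.gr0I)
  have [simp]: "N div \<mu> = \<nu>" using N pos by simp
  have ed: "exact_divisor \<mu> N" using N pos by (simp add: exact_divisor_def)
  have fr: "of_int x / of_nat m \<in> frac_ints n" if "m dvd n" "m > 0" for x :: int and m n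
    using Ints_mult_dvd [of m "of_int x / of_nat m :: rat" n] that by (simp add: frac_ints_def)
  have sq: "k dvd square_part \<mu>" "l dvd square_part \<nu>" using k by (simp_all add: dvd_square_part_iff)
  let ?a = "of_int a / of_nat k :: rat" and ?b = "of_int b / of_nat l :: rat"
  let ?c = "of_int c / of_nat l :: rat" and ?d = "of_int d / of_nat k :: rat"
  have "presentation N (mat2 p q r s) \<mu> ?a ?b ?c ?d"
    unfolding presentation_def using ed fr sq kl pos N
    by (auto simp: eq of_rat_divide)
  moreover have "cancelation_free ?a ?b ?c ?d"
    using no_cancel_of_int_divide [of "int k" "int l"] no_cancel_of_int_divide [of "int l" "int k"] kl cop
    by (auto simp: cancelation_free_def)
  moreover have "mat2 p q r s \<in> Gamma0_star_full N"
    using calculation(1) det unfolding Gamma0_star_full_def mem_Collect_eq mat2_SL2R_iff by blast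
  ultimately show ?thesis
    using fr kl k unfolding Gamma0_star_sigma_def by blast
qed

text \<open>The conclusion leaves \<sigma> free because the level needed for
  \<open>SAut_plus\<close> can be a proper divisor of g; knowing both k | g and k^2 | N is what
  permits that descent.\<close>

lemma level_cond_imp_Gamma0_star_sigma:
  assumes N: "N > 0" and g: "g > 0" and L: "level_cond N g p q r s"
  shows "\<exists>k. k dvd g \<and> k\<^sup>2 dvd N \<and> (\<forall>\<sigma>. k dvd \<sigma> \<longrightarrow> mat2 p q r s \<in> Gamma0_star_sigma N \<sigma>)"
proof -
  note L = L [unfolded level_cond_def]
  have det: "p * s - q * r = 1" using L by simp
  \<comment> \<open>This rescaling puts the off-diagonal pair in the same situation as (p, s):
    squares and product are integral, with q'r' = qr = ps - 1.\<close>
  define q' r' where "q' = q * sqrt (real N)" and "r' = r / sqrt (real N)"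
  have q: "q = q' / sqrt (real N)" and r: "r = r' * sqrt (real N)"
    using N by (simp_all add: q'_def r'_def)
  have q'r': "q' * r' = q * r" using N by (simp add: q'_def r'_def)
  have int: "p\<^sup>2 \<in> \<int>" "s\<^sup>2 \<in> \<int>" "p * s \<in> \<int>" "q'\<^sup>2 \<in> \<int>" "r'\<^sup>2 \<in> \<int>"
    using L by (simp_all add: q'_def r'_def power_mult_distrib power_divide mult.commute)
  have "q' * r' = p * s - 1" using q'r' det by simp
  then have int': "q' * r' \<in> \<int>" using int by simp
  \<comment> \<open>If one pair vanishes it has no common square root. The determinant then forces f
    = 1 for the other pair; antidiagonal matrices get \<mu> = N and diagonal ones \<mu> = 1.\<close>
  consider "p = 0" "s = 0" | "q = 0" "r = 0" | "p \<noteq> 0 \<or> s \<noteq> 0" "q \<noteq> 0 \<or> r \<noteq> 0" by blast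
  then show ?thesis
  proof cases
    case 1
    have "q' * r' = - 1" using q'r' det 1 by simp
    then have "q' \<noteq> 0 \<or> r' \<noteq> 0" by auto
    then obtain f :: nat and \<beta> \<gamma> :: int where f: "f > 0"
      "q' = of_int \<beta> * sqrt (real f)" "r' = of_int \<gamma> * sqrt (real f)"
      using common_sqrt int int' by blast
    have "of_int (int f * \<beta> * \<gamma>) = (of_int (- 1) :: real)"
      using \<open>q' * r' = -1\<close> f by (simp add: algebra_simps)
    then have "int f * \<beta> * \<gamma> = - 1" by (simp only: of_int_eq_iff)
    then have "int f dvd 1" by (metis dvd_minus_iff dvd_mult2 dvd_refl dvd_def mult.assoc)
    then have [simp]: "f = 1" using f by simp
    have "mat2 p q r s \<in> Gamma0_star_sigma N \<sigma>" for \<sigma>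
      by (rule Gamma0_star_sigmaI [of N N 1 1 1 \<sigma> 0 0 \<beta> \<gamma>])
        (use N 1 f q r det in auto)
    then show ?thesis by (intro exI [of _ 1]) auto
  next
    case 2
    have "p * s = 1" using det 2 by simp
    then have "p \<noteq> 0 \<or> s \<noteq> 0" by auto
    then obtain f :: nat and \<beta> \<gamma> :: int where f: "f > 0"
      "p = of_int \<beta> * sqrt (real f)" "s = of_int \<gamma> * sqrt (real f)"
      using common_sqrt int int' by blast
    have "of_int (int f * \<beta> * \<gamma>) = (of_int 1 :: real)"
      using \<open>p * s = 1\<close> f by (simp add: algebra_simps)
    then have "int f * \<beta> * \<gamma> = 1" by (simp only: of_int_eq_iff)
    then have "int f dvd 1" by (metis dvd_mult2 dvd_refl)
    then have [simp]: "f = 1" using f by simp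
    have "mat2 p q r s \<in> Gamma0_star_sigma N \<sigma>" for \<sigma>
      by (rule Gamma0_star_sigmaI [of N 1 N 1 1 \<sigma> \<beta> \<gamma> 0 0])
        (use N 2 f q r det in auto)
    then show ?thesis by (intro exI [of _ 1]) auto
  next
    case 3
    then have "q' \<noteq> 0 \<or> r' \<noteq> 0" using q r by auto
    then obtain f :: nat and \<beta> \<gamma> :: int where f: "f > 0" "coprime \<beta> \<gamma>"
      "q' = of_int \<beta> * sqrt (real f)" "r' = of_int \<gamma> * sqrt (real f)"
      using common_sqrt int int' by blast
    obtain e :: nat and \<alpha> \<delta> :: int where e: "e > 0" "coprime \<alpha> \<delta>"
      "p = of_int \<alpha> * sqrt (real e)" "s = of_int \<delta> * sqrt (real e)"
      using 3 common_sqrt int by blast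
    \<comment> \<open>These are ps and qr as integers, and the determinant becomes u - v = 1; hence
      u and v are coprime and can serve to split N.\<close>
    define u v where "u = int e * \<alpha> * \<delta>" and "v = int f * \<beta> * \<gamma>"
    have "of_int (u - v) = (of_int 1 :: real)"
      using det q'r' e f by (simp add: u_def v_def algebra_simps)
    then have uv: "u - v = 1" by (simp only: of_int_eq_iff)
    then have cuv: "coprime u v"
      by (metis coprimeI dvd_diff)
    define w where "w = sqrt (real (e * f) / real N)"
    have prods: "p * q = of_int (\<alpha> * \<beta>) * w" "s * q = of_int (\<delta> * \<beta>) * w"
      "p * r / real N = of_int (\<alpha> * \<gamma>) * w" "s * r / real N = of_int (\<delta> * \<gamma>) * w"
      using N by (simp_all add: q r e f w_def real_sqrt_mult real_sqrt_divide field_simps)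
    have gprods: "real g * (of_int (\<alpha> * \<beta>) * w) \<in> \<int>" "real g * (of_int (\<delta> * \<beta>) * w) \<in> \<int>"
      "real g * (of_int (\<alpha> * \<gamma>) * w) \<in> \<int>" "real g * (of_int (\<delta> * \<gamma>) * w) \<in> \<int>"
      using L by (simp_all only: flip: prods)
    \<comment> \<open>Coprimality of \<alpha> and \<delta> removes them from the four products, then
      that of \<beta> and \<gamma> removes the rest, leaving the single condition that g w is
      integral.\<close>
    have "of_int \<beta> * (real g * w) \<in> \<int>"
      by (rule Ints_coprime_mult [OF e(2)]) (use gprods in \<open>simp_all add: mult_ac\<close>)
    moreover have "of_int \<gamma> * (real g * w) \<in> \<int>"
      by (rule Ints_coprime_mult [OF e(2)]) (use gprods in \<open>simp_all add: mult_ac\<close>)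
    ultimately have gw: "real g * w \<in> \<int>" by (rule Ints_coprime_mult [OF f(2)])
    have wpos: "w > 0" using e f N by (simp add: w_def)
    have "w = (real g * w) / real g" using g by simp
    then have "w \<in> \<rat>" using gw by (metis Ints_subset_Rats Rats_divide Rats_of_nat subsetD)
    then obtain h k :: nat where hk: "k \<noteq> 0" "w = real h / real k" "coprime h k"
      using Rats_abs_nat_div_natE wpos by (metis abs_of_pos)
    have hpos: "h > 0" using hk wpos by (auto intro: Nat.gr0I)
    have kg: "k dvd g"
    proof -
      obtain z where "real g * w = of_int z" using gw by (auto elim: Ints_cases)
      then have "real g * real h = of_int z * real k" using hk by (simp add: field_simps)
      then have "of_int (int (g * h)) = (of_int (z * int k) :: real)" by simp
      then have "int (g * h) = z * int k" by (simp only: of_int_eq_iff)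
      then have "k dvd g * h" by (metis dvd_triv_right int_dvd_int_iff)
      then show ?thesis using hk(3) by (metis coprime_commute coprime_dvd_mult_left_iff)
    qed
    have "w\<^sup>2 = real (e * f) / real N" using e f by (simp add: w_def)
    then have "real (e * f) * real k ^ 2 = real N * real h ^ 2"
      using hk N by (simp add: power_divide field_simps)
    then have "real (e * f * k ^ 2) = real (N * h ^ 2)" by simp
    then have main: "e * f * k\<^sup>2 = N * h\<^sup>2" by (simp only: of_nat_eq_iff)
    have "coprime (k\<^sup>2) (h\<^sup>2)" using hk(3) by (simp add: coprime_commute)
    then have kN: "k\<^sup>2 dvd N" using main by (metis coprime_dvd_mult_left_iff dvd_triv_right)
    have hef: "h\<^sup>2 dvd e * f"
      using main \<open>coprime (k\<^sup>2) (h\<^sup>2)\<close> by (metis coprime_commute coprime_dvd_mult_left_iff dvd_triv_right)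
    obtain \<mu> \<nu> where mn: "N = \<mu> * \<nu>" "coprime \<mu> \<nu>" "coprime (int \<nu>) u" "coprime (int \<mu>) v"
      using coprime_split [OF N cuv] by blast
    have "int e dvd u" "int f dvd v" "\<alpha> dvd u" "\<delta> dvd u" "\<beta> dvd v" "\<gamma> dvd v"
      by (simp_all add: u_def v_def)
    then have "coprime (int e) (int f)" "coprime (int \<nu>) (int e)" "coprime (int \<mu>) (int f)"
      and cop': "coprime (int \<nu>) \<alpha>" "coprime (int \<nu>) \<delta>"
        "coprime (int \<mu>) \<beta>" "coprime (int \<mu>) \<gamma>"
      using cuv mn(3,4) coprime_divisors dvd_refl by blast+
    then have cop: "coprime e f" "coprime \<nu> e" "coprime \<mu> f" by simp_all
    have "k dvd k\<^sup>2" "h dvd h\<^sup>2" by simp_all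
    then have "k dvd \<mu> * \<nu>" "h dvd e * f" using kN hef mn(1) dvd_trans by blast+
    \<comment> \<open>The denominator k is distributed over \<mu> and \<nu>, the numerator h over e
      and f; k1 and k2 become the denominators of the diagonal and off-diagonal entries.\<close>
    then obtain k1 k2 h1 h2 where k12: "k = k1 * k2" "k1 dvd \<mu>" "k2 dvd \<nu>"
      and h12: "h = h1 * h2" "h1 dvd e" "h2 dvd f"
      using division_decomp by metis
    have d: "k1 dvd k" "k2 dvd k" "h1 dvd h" "h2 dvd h" using k12(1) h12(1) by simp_all
    have c1: "coprime e \<nu>" "coprime f \<mu>" using cop by (simp_all add: coprime_commute)
    have c2: "coprime k1 h1" "coprime k1 h2" "coprime k2 h1" "coprime k2 h2"
      using hk(3) unfolding k12(1) h12(1) by (auto simp: coprime_commute)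
    have c3: "coprime e h2" "coprime f h1"
      using coprime_divisors [OF dvd_refl h12(3) cop(1)] coprime_divisors [OF h12(2) dvd_refl cop(1)]
      by (simp_all add: coprime_commute)
    have c4: "coprime k1 \<nu>" "coprime k2 \<mu>"
      using coprime_divisors [OF k12(2) dvd_refl mn(2)] coprime_divisors [OF dvd_refl k12(3) mn(2)]
      by (simp_all add: coprime_commute)
    have k1: "int k1 dvd int \<mu>" and k2: "int k2 dvd int \<nu>" using k12(2,3) by simp_all
    note c5 = coprime_divisors [OF k2 dvd_refl cop'(1)] coprime_divisors [OF k2 dvd_refl cop'(2)]
      coprime_divisors [OF k1 dvd_refl cop'(3)] coprime_divisors [OF k1 dvd_refl cop'(4)]
    \<comment> \<open>Squaring w = h/k relates only the products ef and \<mu>\<nu>. The identity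
      separates into a diagonal and an off-diagonal one because e k1^2 is coprime to \<nu> h2^2 and
      f k2^2 to \<mu> h1^2.\<close>
    have main': "(e * k1\<^sup>2) * (f * k2\<^sup>2) = (\<mu> * h1\<^sup>2) * (\<nu> * h2\<^sup>2)"
      using main unfolding k12(1) h12(1) mn(1) by (simp add: power_mult_distrib mult_ac)
    have "coprime (e * k1\<^sup>2) (\<nu> * h2\<^sup>2)" "coprime (f * k2\<^sup>2) (\<mu> * h1\<^sup>2)"
      using c1 c2 c3 c4 by auto
    then have eqs: "e * k1\<^sup>2 = \<mu> * h1\<^sup>2" "f * k2\<^sup>2 = \<nu> * h2\<^sup>2"
      using coprime_crossproduct_nat [of "e * k1\<^sup>2" "\<nu> * h2\<^sup>2" "\<mu> * h1\<^sup>2" "f * k2\<^sup>2"] main'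
      by (simp_all add: coprime_commute mult_ac)
    have pos: "k1 > 0" "k2 > 0" "h1 > 0" "h2 > 0" "\<mu> > 0" "\<nu> > 0"
      using hk(1) k12(1) h12(1) hpos N mn(1) by (auto intro!: Nat.gr0I)
    have sqrts: "sqrt (real e) * real k1 = sqrt (real \<mu>) * real h1"
       "sqrt (real f) * real k2 = sqrt (real \<nu>) * real h2"
      using arg_cong [OF eqs(1), of "\<lambda>n. sqrt (real n)"] arg_cong [OF eqs(2), of "\<lambda>n. sqrt (real n)"]
      by (simp_all add: real_sqrt_mult)
    then have se: "sqrt (real e) = real h1 / real k1 * sqrt (real \<mu>)"
       and sf: "sqrt (real f) = real h2 / real k2 * sqrt (real \<nu>)"
      using pos by (simp_all add: field_simps)
    have sq: "k1\<^sup>2 dvd \<mu>" "k2\<^sup>2 dvd \<nu>"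
      using eqs c2(1,4) by (metis coprime_dvd_mult_left_iff coprime_power_left_iff coprime_power_right_iff dvd_triv_right)+
    have "mat2 p q r s \<in> Gamma0_star_sigma N \<sigma>" if "k dvd \<sigma>" for \<sigma>
    proof (rule Gamma0_star_sigmaI [of N \<mu> \<nu> k1 k2 \<sigma>
          "\<alpha> * int h1" "\<delta> * int h1" "\<beta> * int h2" "\<gamma> * int h2"])
      show "k1 dvd \<sigma>" "k2 dvd \<sigma>" using that d dvd_trans by blast+
      show "coprime (\<alpha> * int h1) (int k2)" "coprime (\<delta> * int h1) (int k2)"
           "coprime (\<beta> * int h2) (int k1)" "coprime (\<gamma> * int h2) (int k1)"
        using c5 c2 by (simp_all add: coprime_commute)
      show "p = of_int (\<alpha> * int h1) / real k1 * sqrt (real \<mu>)"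
        "s = of_int (\<delta> * int h1) / real k1 * sqrt (real \<mu>)"
        by (simp_all add: e se)
      show "q = of_int (\<beta> * int h2) / real k2 / sqrt (real \<mu>)"
        "r = of_int (\<gamma> * int h2) / real k2 * real \<nu> * sqrt (real \<mu>)"
        using pos by (simp_all add: q r f sf mn(1) real_sqrt_mult field_simps)
    qed (use mn N sq det in auto)
    then show ?thesis using kg kN by blast
  qed
qed

text \<open>Products within one pair of entries are cleared by s_\<mu>^2 | \<mu> or s_\<nu>^2 |
  \<nu>. Mixed products are cleared by \<sigma> because s_\<mu> and s_\<nu> are coprime, as \<mu> is
  an exact divisor.\<close>

lemma Gamma0_star_sigma_imp_level_cond:
  assumes N: "N > 0" and A: "mat2 p q r s \<in> Gamma0_star_sigma N \<sigma>"
  shows "level_cond N \<sigma> p q r s"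
proof -
  obtain \<mu> a b c d where pres: "presentation N (mat2 p q r s) \<mu> a b c d"
    and fr: "a \<in> frac_ints \<sigma>" "b \<in> frac_ints \<sigma>" "c \<in> frac_ints \<sigma>" "d \<in> frac_ints \<sigma>"
    and det: "p * s - q * r = 1"
    using A by (auto simp: Gamma0_star_sigma_def Gamma0_star_full_def mat2_SL2R_iff)
  define \<nu> where "\<nu> = N div \<mu>"
  have N_eq: "N = \<mu> * \<nu>" and cop: "coprime \<mu> \<nu>"
    using pres by (auto simp: presentation_def exact_divisor_def \<nu>_def)
  then have pos: "\<mu> > 0" "\<nu> > 0" using N by auto
  let ?m = "square_part \<mu>" and ?n = "square_part \<nu>"
  have fr': "a \<in> frac_ints ?m" "d \<in> frac_ints ?m" "b \<in> frac_ints ?n" "c \<in> frac_ints ?n"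
    and p: "p = of_rat a * sqrt (real \<mu>)" and s: "s = of_rat d * sqrt (real \<mu>)"
    and q: "q = of_rat b / sqrt (real \<mu>)" and r: "r = of_rat c * real \<nu> * sqrt (real \<mu>)"
    using pres pos by (simp_all add: presentation_def \<nu>_def [symmetric]) (simp add: N_eq)
  have cop': "coprime ?m ?n"
    using cop by (meson coprime_divisors dvd_power dvd_trans pos2 square_part_square_dvd)
  have real: "real n * of_rat x \<in> \<int>" if h: "of_nat n * x \<in> \<int>" for n and x :: rat
  proof -
    obtain z where "of_nat n * x = of_int z" using h by (rule Ints_cases)
    then have "real n * of_rat x = of_int z" by (metis of_rat_mult of_rat_of_int_eq of_rat_of_nat_eq)
    then show ?thesis by simp
  qed
  have 1: "real \<mu> * of_rat (a * a) \<in> \<int>" "real \<mu> * of_rat (d * d) \<in> \<int>" "real \<mu> * of_rat (a * d) \<in> \<int>"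
    "real \<nu> * of_rat (b * b) \<in> \<int>" "real \<nu> * of_rat (c * c) \<in> \<int>"
    using fr' Ints_frac_ints_product real square_part_square_dvd by blast+
  have 2: "real \<sigma> * of_rat (a * b) \<in> \<int>" "real \<sigma> * of_rat (d * b) \<in> \<int>"
    "real \<sigma> * of_rat (a * c) \<in> \<int>" "real \<sigma> * of_rat (d * c) \<in> \<int>"
    using fr fr' cop' Ints_frac_ints_coprime_product real by blast+
  have [simp]: "sqrt (real \<mu>) * (sqrt (real \<mu>) * x) = real \<mu> * x" for x
    by (simp flip: mult.assoc)
  have eqs: "p\<^sup>2 = real \<mu> * of_rat (a * a)" "s\<^sup>2 = real \<mu> * of_rat (d * d)"
    "p * s = real \<mu> * of_rat (a * d)"
    "real N * q\<^sup>2 = real \<nu> * of_rat (b * b)" "r\<^sup>2 / real N = real \<nu> * of_rat (c * c)"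
    "p * q = of_rat (a * b)" "s * q = of_rat (d * b)"
    "p * r / real N = of_rat (a * c)" "s * r / real N = of_rat (d * c)"
    unfolding p q r s N_eq using pos
    by (simp_all add: of_rat_mult power2_eq_square field_simps)
  show ?thesis
    unfolding level_cond_def using det 1 2 by (simp only: eqs)
qed

lemma Gamma0_star_sigma_iff:
  assumes "N > 0" "\<sigma> > 0"
  shows "mat2 p q r s \<in> Gamma0_star_sigma N \<sigma> \<longleftrightarrow> level_cond N \<sigma> p q r s"
  using Gamma0_star_sigma_imp_level_cond level_cond_imp_Gamma0_star_sigma assms by blast

text \<open>The last two properties connect the levels: every k dividing gcd(D, 2N/D) with k^2 | N
  already divides \<open>sigma_level N D\<close>, so presentations descend to it, while level
  conditions pass back up to the gcd.\<close>

lemma sigma_level_properties: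
  assumes "N > 0" "D dvd N"
  shows "sigma_level N D > 0" "sigma_level N D dvd gcd D (2 * N div D)"
    "\<And>k. k dvd gcd D (2 * N div D) \<Longrightarrow> k\<^sup>2 dvd N \<Longrightarrow> k dvd sigma_level N D"
proof -
  obtain M where M: "N = D * M" using assms(2) ..
  then have pos: "D > 0" "M > 0" using assms by auto
  have g: "gcd D (2 * N div D) = gcd D (2 * M)"
    using pos by (metis M mult.left_commute nonzero_mult_div_cancel_left less_numeral_extra(3))
  define G where "G = gcd D (2 * M)"
  have G0: "G > 0" using pos by (simp add: G_def)
  have "sigma_level N D > 0 \<and> sigma_level N D dvd G \<and>
    (\<forall>k. k dvd G \<longrightarrow> k\<^sup>2 dvd N \<longrightarrow> k dvd sigma_level N D)"
  proof (cases "2 * multiplicity 2 D = multiplicity 2 N + 1")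
    case True
    let ?v = "multiplicity (2::nat)"
    have "?v N = ?v D + ?v M" unfolding M using pos by (simp add: prime_elem_multiplicity_mult_distrib)
    \<comment> \<open>The 2-adic valuation of G is min(v(D), v(M) + 1); its double exceeds v(N) =
      v(D) + v(M) precisely in this case.\<close>
    then have v: "?v D = ?v M + 1" using True by simp
    have "2 ^ ?v D dvd D" by (rule multiplicity_dvd)
    moreover have "2 * 2 ^ ?v M dvd 2 * M" by (intro mult_dvd_mono multiplicity_dvd dvd_refl)
    ultimately have G2: "2 ^ ?v D dvd G" using v by (simp add: G_def)
    then have "even G" using v by (metis dvd_power dvd_trans zero_less_Suc add_gr_0 zero_less_one)
    then have G: "G = 2 * (G div 2)" by simp
    have s: "sigma_level N D = G div 2" using True by (simp add: sigma_level_def g G_def)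
    have k: "k dvd G div 2" if k: "k dvd G" "k\<^sup>2 dvd N" for k
    proof -
      obtain j where j: "G = k * j" using k(1) ..
      show ?thesis
      proof (cases "even j")
        case True
        then show ?thesis using j by auto
      next
        case False
        \<comment> \<open>With an odd cofactor, k would carry the full 2-part of D, and k^2 | N
          would contradict 2 v(D) = v(N) + 1. So k already divides G/2.\<close>
        then have "coprime (2 ^ ?v D) j" by simp
        then have "2 ^ ?v D dvd k" using G2 j by (metis coprime_dvd_mult_left_iff)
        then have "(2 ^ ?v D)\<^sup>2 dvd N" using k(2) by (meson dvd_power_same dvd_trans)
        then have "2 ^ (?v D * 2) dvd N" by (simp add: power_mult)
        then have "?v D * 2 \<le> ?v N" using assms(1) by (simp add: multiplicity_geI)
        then show ?thesis using \<open>2 * ?v D = ?v N + 1\<close> by simp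
      qed
    qed
    show ?thesis
      using G G0 k unfolding s by (metis dvd_triv_right gr0I mult_0_right)
  next
    case False
    then show ?thesis using G0 by (simp add: sigma_level_def g G_def)
  qed
  then show "sigma_level N D > 0" "sigma_level N D dvd gcd D (2 * N div D)"
    "\<And>k. k dvd gcd D (2 * N div D) \<Longrightarrow> k\<^sup>2 dvd N \<Longrightarrow> k dvd sigma_level N D"
    by (simp_all add: g G_def)
qed

subsection \<open>Lattices in coordinates\<close>

lemma mat2_add: "mat2 a b c d + mat2 a' b' c' d' = mat2 (a + a') (b + b') (c + c') (d + d')"
  and mat2_diff: "mat2 a b c d - mat2 a' b' c' d' = mat2 (a - a') (b - b') (c - c') (d - d')"
  and mat2_uminus: "- mat2 a b c d = mat2 (- a) (- b) (- c) (- d)"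
  and mat2_scaleR: "x *\<^sub>R mat2 a b c d = mat2 (x * a) (x * b) (x * c) (x * d)"
  and mat2_0: "0 = mat2 0 0 0 0"
  by (simp_all add: vec_eq_iff forall_2)

lemma mat2_mult:
  "mat2 a b c d ** mat2 a' b' c' d' =
     mat2 (a * a' + b * c') (a * b' + b * d') (c * a' + d * c') (c * b' + d * d')"
  by (simp add: vec_eq_iff forall_2 matrix_matrix_mult_def sum_2)

lemma trace_mat2: "trace (mat2 a b c d) = a + d"
  by (simp add: trace_def sum_2)

lemma mat_1_eq_mat2: "mat 1 = mat2 1 0 0 1"
  by (simp add: vec_eq_iff forall_2 mat_def)

lemma matrix_inv_mat2:
  assumes "p * s - q * r = 1"
  shows "matrix_inv (mat2 p q r s) = mat2 s (- q) (- r) p"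
proof -
  let ?A = "mat2 p q r s" and ?B = "mat2 s (- q) (- r) p"
  have *: "?A ** ?B = mat 1" "?B ** ?A = mat 1"
    using assms by (simp_all add: mat2_mult mat_1_eq_mat2 mult.commute)
  have uniq: "X = ?B" if "?A ** X = mat 1" for X
  proof -
    have "X = ?B ** (?A ** X)" by (simp add: matrix_mul_assoc *(2))
    then show ?thesis by (simp add: that)
  qed
  show ?thesis
    unfolding matrix_inv_def by (rule some_equality) (simp add: *, blast intro: uniq)
qed

lemma matrix_add_rdistrib: "(A + B) ** C = A ** C + B ** (C :: 'a::semiring_1^'n^'m)"
  by (vector matrix_matrix_mult_def sum.distrib distrib_right)

lemma conj_act_add: "conj_act A (X + Y) = conj_act A X + conj_act A Y"
  by (simp add: conj_act_def matrix_add_ldistrib matrix_add_rdistrib)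

lemma conj_act_diff: "conj_act A (X - Y) = conj_act A X - conj_act A Y"
  using conj_act_add [of A "X - Y" Y] by (simp add: eq_diff_eq)

lemma conj_act_inverse:
  assumes "p * s - q * r = 1"
  shows "conj_act (mat2 p q r s) (conj_act (mat2 s (- q) (- r) p) X) = X"
proof -
  let ?A = "mat2 p q r s" and ?B = "mat2 s (- q) (- r) p"
  have 1: "?A ** ?B = mat 1" using assms by (simp add: mat2_mult mat_1_eq_mat2 mult.commute)
  have "matrix_inv ?A = ?B" "matrix_inv ?B = ?A"
    using matrix_inv_mat2 [of p s q r] matrix_inv_mat2 [of s p "- q" "- r"] assms
    by (simp_all add: mult.commute)
  then have "conj_act ?A (conj_act ?B X) = (?A ** ?B) ** X ** (?A ** ?B)"
    by (simp add: conj_act_def matrix_mul_assoc)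
  then show ?thesis by (simp add: 1)
qed

text \<open>Replaces surjectivity by a second inclusion, for the inverse matrix, so that only
  inclusions have to be translated into integrality.\<close>

lemma conj_act_image_eq_iff:
  assumes "p * s - q * r = 1"
  shows "conj_act (mat2 p q r s) ` W = W \<longleftrightarrow>
    conj_act (mat2 p q r s) ` W \<subseteq> W \<and> conj_act (mat2 s (- q) (- r) p) ` W \<subseteq> W"
proof -
  have 1: "conj_act (mat2 p q r s) (conj_act (mat2 s (- q) (- r) p) X) = X" for X
    using conj_act_inverse assms by blast
  have 2: "conj_act (mat2 s (- q) (- r) p) (conj_act (mat2 p q r s) X) = X" for X
    using conj_act_inverse [of s p "- q" "- r"] assms by (simp add: mult.commute)
  have 3: "conj_act (mat2 p q r s) ` conj_act (mat2 s (- q) (- r) p) ` W = W"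
    "conj_act (mat2 s (- q) (- r) p) ` conj_act (mat2 p q r s) ` W = W"
    by (simp_all add: image_image 1 2)
  show ?thesis
    using 3 image_mono [of "conj_act (mat2 s (- q) (- r) p) ` W" W "conj_act (mat2 p q r s)"] by auto
qed

text \<open>The two sign patterns that occur in the coordinates of a conjugated vector.\<close>

lemma Ints_combination:
  fixes x y z u v w :: "'a::ring_1"
  assumes "x \<in> \<int>" "u \<in> \<int>" "y \<in> \<int>" "v \<in> \<int>" "z \<in> \<int>" "w \<in> \<int>"
  shows "x * u + y * v - z * w \<in> \<int>" "x * u - y * v - z * w \<in> \<int>"
  using assms by simp_all

lemma mat2_set_eqI:
  assumes "\<And>p q r s. mat2 p q r s \<in> S \<longleftrightarrow> mat2 p q r s \<in> T"
  shows "S = T"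
  using assms mat2_eta by (metis subsetI subset_antisym)

text \<open>M stands for N/D; carrying it as a parameter avoids truncated division.\<close>

locale disc_lattice =
  fixes N D M :: nat
  assumes N_eq: "N = D * M" and N_pos: "N > 0"
begin

lemma D_pos: "D > 0" and M_pos: "M > 0"
  using N_eq N_pos by auto

text \<open>Coordinates along H, E, F, in this order, for the given basis of L(N,D), whose scalars
  simplify to sqrt(M), 1/sqrt(M) and D sqrt(M).\<close>

definition lv :: "real \<Rightarrow> real \<Rightarrow> real \<Rightarrow> real^2^2" where
  "lv k i j = mat2 (k * sqrt M) (i / sqrt M) (j * (D * sqrt M)) (- (k * sqrt M))"

lemma lv_add: "lv k i j + lv k' i' j' = lv (k + k') (i + i') (j + j')"
  and lv_diff: "lv k i j - lv k' i' j' = lv (k - k') (i - i') (j - j')"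
  and lv_uminus: "- lv k i j = lv (- k) (- i) (- j)"
  and lv_scaleR: "x *\<^sub>R lv k i j = lv (x * k) (x * i) (x * j)"
  and lv_0: "0 = lv 0 0 0"
  by (simp_all add: lv_def mat2_add mat2_diff mat2_uminus mat2_scaleR mat2_0 algebra_simps
      add_divide_distrib diff_divide_distrib)

lemma lv_eq_iff: "lv k i j = lv k' i' j' \<longleftrightarrow> k = k' \<and> i = i' \<and> j = j'"
  using M_pos D_pos by (auto simp: lv_def)

lemma traceless_lv:
  assumes "trace X = 0"
  shows "\<exists>k i j. X = lv k i j"
proof -
  have "X = lv (X$1$1 / sqrt M) (X$1$2 * sqrt M) (X$2$1 / (D * sqrt M))"
    using assms M_pos D_pos mat2_eta [of X, symmetric]
    by (simp add: lv_def trace_def sum_2 eq_neg_iff_add_eq_0 add.commute vec_eq_iff forall_2)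
  then show ?thesis by blast
qed

text \<open>The lattice generated by the basis of L(N,D) divided by a, b, c, for positive
  parameters. L itself is (1,1,1), its dual is (2M,D,D), and the pre-images of the subgroups H, E, F
  and E + F are (2M,1,1), (1,D,1), (1,1,D) and (1,D,D). The number 1 appears as
  \<open>Suc 0\<close>, its simplifier normal form.\<close>

definition W :: "nat \<Rightarrow> nat \<Rightarrow> nat \<Rightarrow> (real^2^2) set" where
  "W a b c = {lv k i j | k i j :: real. a * k \<in> \<int> \<and> b * i \<in> \<int> \<and> c * j \<in> \<int>}"

lemma lv_in_W_iff: "lv k i j \<in> W a b c \<longleftrightarrow> a * k \<in> \<int> \<and> b * i \<in> \<int> \<and> c * j \<in> \<int>"
  for k i j :: real
  unfolding W_def mem_Collect_eq lv_eq_iff by blast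

lemma W_cases:
  assumes "X \<in> W a b c"
  obtains k i j :: real where "X = lv k i j" "a * k \<in> \<int>" "b * i \<in> \<int>" "c * j \<in> \<int>"
  using assms unfolding W_def by blast

lemma W_closed:
  "0 \<in> W a b c" "X \<in> W a b c \<Longrightarrow> - X \<in> W a b c"
  "X \<in> W a b c \<Longrightarrow> Y \<in> W a b c \<Longrightarrow> X + Y \<in> W a b c"
  "X \<in> W a b c \<Longrightarrow> Y \<in> W a b c \<Longrightarrow> X - Y \<in> W a b c"
  by (auto simp: lv_0 lv_in_W_iff lv_uminus lv_add lv_diff algebra_simps elim!: W_cases)

lemma W_1_subset: "W (Suc 0) (Suc 0) (Suc 0) \<subseteq> W a b c"
  by (auto simp: lv_in_W_iff elim!: W_cases)

lemma lattice_L_eq: "lattice_L N D = W (Suc 0) (Suc 0) (Suc 0)"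
proof -
  have eq: "of_int i *\<^sub>R ((sqrt (real D) / sqrt (real N)) *\<^sub>R mat_E)
      + of_int j *\<^sub>R (sqrt (real N * real D) *\<^sub>R mat_F)
      + of_int k *\<^sub>R ((sqrt (real N) / sqrt (real D)) *\<^sub>R mat_H) = lv (of_int k) (of_int i) (of_int j)"
    for i j k
    using D_pos M_pos
    by (simp add: lv_def mat_E_def mat_F_def mat_H_def mat2_scaleR mat2_add N_eq real_sqrt_mult
        field_simps)
  show ?thesis
    unfolding lattice_L_def eq W_def Ints_def by auto blast
qed

lemma bform_lv: "bform (lv k i j) (lv k' i' j') = 2 * M * k * k' + D * (i * j' + j * i')"
  for k i j k' i' j' :: real
  using M_pos by (simp add: bform_def lv_def mat2_mult trace_mat2 field_simps)

text \<open>The H-line is orthogonal to E and F with norm 2M, while E and F are isotropic and pair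
  to D. Testing against the three basis vectors therefore yields 2Mk, Dj and Di.\<close>

lemma dual_lattice_eq: "dual_lattice (lattice_L N D) = W (2 * M) D D"
proof (rule Set.set_eqI, rule iffI)
  fix X assume X: "X \<in> dual_lattice (lattice_L N D)"
  then obtain k i j where X_eq: "X = lv k i j"
    using traceless_lv unfolding dual_lattice_def by blast
  have *: "bform X (lv x y z) \<in> \<int>" if "x \<in> \<int>" "y \<in> \<int>" "z \<in> \<int>" for x y z :: real
    using X that by (auto simp: dual_lattice_def lattice_L_eq lv_in_W_iff)
  show "X \<in> W (2 * M) D D"
    using * [of 1 0 0] * [of 0 1 0] * [of 0 0 1] by (simp add: X_eq bform_lv lv_in_W_iff)
next
  fix X assume "X \<in> W (2 * M) D D"
  then obtain k i j :: real where X: "X = lv k i j" "real (2 * M) * k \<in> \<int>" "D * i \<in> \<int>" "D * j \<in> \<int>"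
    by (rule W_cases)
  have "bform X Y \<in> \<int>" if "Y \<in> W (Suc 0) (Suc 0) (Suc 0)" for Y
    using that
  proof (rule W_cases)
    fix x y z :: real assume Y: "Y = lv x y z" "real (Suc 0) * x \<in> \<int>" "real (Suc 0) * y \<in> \<int>" "real (Suc 0) * z \<in> \<int>"
    have "bform X Y = (real (2 * M) * k) * x + ((D * i) * z + (D * j) * y)"
      unfolding X(1) Y(1) bform_lv by (simp add: algebra_simps)
    then show ?thesis using X Y by simp
  qed
  moreover have "trace X = 0" by (simp add: X lv_def trace_mat2)
  ultimately show "X \<in> dual_lattice (lattice_L N D)" by (simp add: dual_lattice_def lattice_L_eq)
qed

text \<open>The adjoint representation in the basis of L(N,D): its nine matrix entries are the
  source of every monomial condition below.\<close>

lemma conj_act_lv: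
  fixes p q r s k i j :: real
  assumes "p * s - q * r = 1"
  shows "conj_act (mat2 p q r s) (lv k i j) =
    lv (k * (p * s + q * r) + j * (D * (q * s)) - i * (p * r / M))
       (p\<^sup>2 * i - 2 * M * (p * q) * k - q\<^sup>2 * N * j)
       (2 * (r * s) / D * k + s\<^sup>2 * j - r\<^sup>2 / N * i)"
  unfolding conj_act_def matrix_inv_mat2 [OF assms] lv_def mat2_mult mat2_eq_iff
  using M_pos D_pos by (auto simp: N_eq power2_eq_square field_simps)

text \<open>The conditions say that the adjoint matrix, rewritten in the basis of L(N,D) divided by
  a, b, c, has integral entries. Necessity is tested on these generators, which exist because a, b,
  c are positive.\<close>

lemma conj_act_W_subset_iff:
  fixes p q r s :: real
  assumes det: "p * s - q * r = 1" and pos: "a > 0" "b > 0" "c > 0"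
  shows "conj_act (mat2 p q r s) ` W a b c \<subseteq> W a b c \<longleftrightarrow>
    p * s + q * r \<in> \<int> \<and> p\<^sup>2 \<in> \<int> \<and> s\<^sup>2 \<in> \<int> \<and> a * D * (q * s) / c \<in> \<int> \<and> a * (p * r) / (M * b) \<in> \<int> \<and>
    b * (2 * M * (p * q)) / a \<in> \<int> \<and> b * (q\<^sup>2 * N) / c \<in> \<int> \<and>
    c * (2 * (r * s)) / (D * a) \<in> \<int> \<and> c * r\<^sup>2 / (N * b) \<in> \<int>"
    (is "?L \<longleftrightarrow> ?R")
proof
  assume ?L
  then have *: "conj_act (mat2 p q r s) (lv k i j) \<in> W a b c"
    if "a * k \<in> \<int>" "b * i \<in> \<int>" "c * j \<in> \<int>" for k i j :: real
    using that by (auto simp: lv_in_W_iff)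
  show ?R
    using * [of "1 / real a" 0 0] * [of 0 "1 / real b" 0] * [of 0 0 "1 / real c"] pos
    by (simp add: conj_act_lv [OF det] lv_in_W_iff mult_ac)
next
  assume R: ?R
  show ?L
  proof (intro image_subsetI, elim W_cases)
    fix X and k i j :: real assume X: "X = lv k i j" "a * k \<in> \<int>" "b * i \<in> \<int>" "c * j \<in> \<int>"
    have e1: "a * (k * (p * s + q * r) + j * (D * (q * s)) - i * (p * r / M)) =
      (a * k) * (p * s + q * r) + (c * j) * (a * D * (q * s) / c) - (b * i) * (a * (p * r) / (M * b))"
      using pos M_pos by (simp add: field_simps)
    have e2: "b * (p\<^sup>2 * i - 2 * M * (p * q) * k - q\<^sup>2 * N * j) =
      p\<^sup>2 * (b * i) - (b * (2 * M * (p * q)) / a) * (a * k) - (b * (q\<^sup>2 * N) / c) * (c * j)"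
      using pos by (simp add: field_simps)
    have e3: "c * (2 * (r * s) / D * k + s\<^sup>2 * j - r\<^sup>2 / N * i) =
      (c * (2 * (r * s)) / (D * a)) * (a * k) + s\<^sup>2 * (c * j) - (c * r\<^sup>2 / (N * b)) * (b * i)"
      using pos D_pos N_pos by (simp add: field_simps)
    show "conj_act (mat2 p q r s) X \<in> W a b c"
      unfolding X(1) conj_act_lv [OF det] lv_in_W_iff e1 e2 e3
      by (intro conjI Ints_combination; use R X(2-4) in blast)
  qed
qed

text \<open>The inverse exchanges p and s and negates q and r. Five of the nine conditions are
  stable under this up to exchange and the other four acquire a partner, which makes
  thirteen.\<close>

lemma conj_act_W_eq_iff:
  fixes p q r s :: real
  assumes det: "p * s - q * r = 1" and pos: "a > 0" "b > 0" "c > 0"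
  shows "conj_act (mat2 p q r s) ` W a b c = W a b c \<longleftrightarrow>
    p * s + q * r \<in> \<int> \<and> p\<^sup>2 \<in> \<int> \<and> s\<^sup>2 \<in> \<int> \<and>
    a * D * (q * s) / c \<in> \<int> \<and> a * D * (q * p) / c \<in> \<int> \<and>
    a * (p * r) / (M * b) \<in> \<int> \<and> a * (s * r) / (M * b) \<in> \<int> \<and>
    b * (2 * M * (p * q)) / a \<in> \<int> \<and> b * (2 * M * (s * q)) / a \<in> \<int> \<and> b * (q\<^sup>2 * N) / c \<in> \<int> \<and>
    c * (2 * (r * s)) / (D * a) \<in> \<int> \<and> c * (2 * (r * p)) / (D * a) \<in> \<int> \<and> c * r\<^sup>2 / (N * b) \<in> \<int>"
proof -
  have det': "s * p - (- q) * (- r) = 1" using det by (simp add: mult.commute)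
  show ?thesis
    unfolding conj_act_image_eq_iff [OF det] conj_act_W_subset_iff [OF det pos]
      conj_act_W_subset_iff [OF det' pos]
    by (auto simp: mult_ac)
qed

text \<open>Integrality of the entries of the adjoint matrix minus the identity, with source basis
  divided by a, b, c and target basis that of L. Since ps + qr - 1 = 2qr, the first diagonal entry
  becomes 2qr/a.\<close>

lemma conj_act_fixes_W_iff:
  fixes p q r s :: real
  assumes det: "p * s - q * r = 1" and pos: "a > 0" "b > 0" "c > 0"
  shows "(\<forall>X\<in>W a b c. conj_act (mat2 p q r s) X - X \<in> lattice_L N D) \<longleftrightarrow>
    2 * (q * r) / a \<in> \<int> \<and> (p\<^sup>2 - 1) / b \<in> \<int> \<and> (s\<^sup>2 - 1) / c \<in> \<int> \<and>
    D * (q * s) / c \<in> \<int> \<and> p * r / (M * b) \<in> \<int> \<and> 2 * M * (p * q) / a \<in> \<int> \<and> q\<^sup>2 * N / c \<in> \<int> \<and>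
    2 * (r * s) / (D * a) \<in> \<int> \<and> r\<^sup>2 / (N * b) \<in> \<int>"
    (is "?L \<longleftrightarrow> ?R")
proof -
  have det2: "p * s + q * r = 1 + 2 * (q * r)" using det by simp
  have diff: "conj_act (mat2 p q r s) (lv k i j) - lv k i j =
    lv (k * (2 * (q * r)) + j * (D * (q * s)) - i * (p * r / M))
       ((p\<^sup>2 - 1) * i - 2 * M * (p * q) * k - q\<^sup>2 * N * j)
       (2 * (r * s) / D * k + (s\<^sup>2 - 1) * j - r\<^sup>2 / N * i)" for k i j :: real
    unfolding conj_act_lv [OF det] lv_diff lv_eq_iff det2 by (simp add: algebra_simps)
  show ?thesis
  proof
    assume ?L
    then have *: "conj_act (mat2 p q r s) (lv k i j) - lv k i j \<in> W (Suc 0) (Suc 0) (Suc 0)"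
      if "a * k \<in> \<int>" "b * i \<in> \<int>" "c * j \<in> \<int>" for k i j :: real
      using that by (auto simp: lv_in_W_iff lattice_L_eq)
    show ?R
      using * [of "1 / real a" 0 0] * [of 0 "1 / real b" 0] * [of 0 0 "1 / real c"] pos
      by (simp add: diff lv_in_W_iff mult_ac)
  next
    assume R: ?R
    show ?L
    proof (intro ballI, elim W_cases)
      fix X and k i j :: real assume X: "X = lv k i j" "a * k \<in> \<int>" "b * i \<in> \<int>" "c * j \<in> \<int>"
      have e1: "k * (2 * (q * r)) + j * (D * (q * s)) - i * (p * r / M) =
        (a * k) * (2 * (q * r) / a) + (c * j) * (D * (q * s) / c) - (b * i) * (p * r / (M * b))"
        using pos M_pos by (simp add: field_simps)
      have e2: "(p\<^sup>2 - 1) * i - 2 * M * (p * q) * k - q\<^sup>2 * N * j =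
        ((p\<^sup>2 - 1) / b) * (b * i) - (2 * M * (p * q) / a) * (a * k) - (q\<^sup>2 * N / c) * (c * j)"
        using pos by (simp add: field_simps)
      have e3: "2 * (r * s) / D * k + (s\<^sup>2 - 1) * j - r\<^sup>2 / N * i =
        (2 * (r * s) / (D * a)) * (a * k) + ((s\<^sup>2 - 1) / c) * (c * j) - (r\<^sup>2 / (N * b)) * (b * i)"
        using pos D_pos N_pos by (simp add: field_simps)
      have *: "real (Suc 0) * x = x" for x by simp
      show "conj_act (mat2 p q r s) X - X \<in> lattice_L N D"
        unfolding X(1) diff lattice_L_eq lv_in_W_iff * e1 e2 e3
        by (intro conjI Ints_combination; use R X(2-4) in blast)
    qed
  qed
qed

end

subsection \<open>The discriminant group\<close>

lemma comm_group_add_monoid_on: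
  assumes "0 \<in> V" "\<And>X Y. X \<in> V \<Longrightarrow> Y \<in> V \<Longrightarrow> X + Y \<in> V" "\<And>X. X \<in> V \<Longrightarrow> - X \<in> V"
  shows "comm_group (add_monoid_on V)"
proof (rule comm_groupI)
  show "\<exists>Y\<in>carrier (add_monoid_on V). Y \<otimes>\<^bsub>add_monoid_on V\<^esub> X = \<one>\<^bsub>add_monoid_on V\<^esub>"
    if "X \<in> carrier (add_monoid_on V)" for X
    using that assms(3) by (auto simp: add_monoid_on_def intro!: bexI [of _ "- X"])
qed (use assms in \<open>auto simp: add_monoid_on_def algebra_simps\<close>)

context disc_lattice
begin

abbreviation "L \<equiv> lattice_L N D"
abbreviation "G \<equiv> add_monoid_on (dual_lattice L)"

lemma comm_group_G: "comm_group G"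
  unfolding dual_lattice_eq by (intro comm_group_add_monoid_on W_closed)

lemma G_simps:
  "carrier G = W (2 * M) D D" "X \<otimes>\<^bsub>G\<^esub> Y = X + Y" "\<one>\<^bsub>G\<^esub> = 0"
  by (simp_all add: add_monoid_on_def dual_lattice_eq)

lemma inv_G: "X \<in> W (2 * M) D D \<Longrightarrow> inv\<^bsub>G\<^esub> X = - X"
  using group.inv_equality [OF comm_group.axioms(2) [OF comm_group_G], of "- X" X]
  by (simp add: G_simps W_closed)

lemma L_closed:
  "0 \<in> L" "X \<in> L \<Longrightarrow> - X \<in> L" "X \<in> L \<Longrightarrow> Y \<in> L \<Longrightarrow> X + Y \<in> L" "X \<in> L \<Longrightarrow> Y \<in> L \<Longrightarrow> X - Y \<in> L"
  by (simp_all add: lattice_L_eq W_closed)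

lemma L_normal: "L \<lhd> G"
proof -
  interpret comm_group G by (rule comm_group_G)
  show ?thesis
  proof (rule subgroup_imp_normal, rule subgroupI)
    show "L \<subseteq> carrier G" unfolding G_simps unfolding lattice_L_eq by (rule W_1_subset)
    then show "inv\<^bsub>G\<^esub> X \<in> L" if "X \<in> L" for X
      using that inv_G [of X] L_closed(2) by (auto simp: G_simps)
    show "L \<noteq> {}" using L_closed(1) by blast
    show "X \<otimes>\<^bsub>G\<^esub> Y \<in> L" if "X \<in> L" "Y \<in> L" for X Y
      using that by (simp add: G_simps L_closed)
  qed
qed

lemma int_pow_G:
  assumes "X \<in> W (2 * M) D D"
  shows "X [^]\<^bsub>G\<^esub> (n :: int) = of_int n *\<^sub>R X"
proof -
  interpret comm_group G by (rule comm_group_G)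
  have nat: "X [^]\<^bsub>G\<^esub> (m :: nat) = of_nat m *\<^sub>R X" for m
    by (induction m) (simp_all add: G_simps nat_pow_0 nat_pow_Suc scaleR_add_left add.commute)
  have "X [^]\<^bsub>G\<^esub> (m :: nat) \<in> W (2 * M) D D" for m
    using assms nat_pow_closed [of X m] by (simp add: G_simps)
  then have "inv\<^bsub>G\<^esub> (X [^]\<^bsub>G\<^esub> nat (- n)) = - (X [^]\<^bsub>G\<^esub> nat (- n))" by (rule inv_G)
  then show ?thesis by (cases "n < 0") (simp_all add: int_pow_def2 nat)
qed

lemma mem_disc_class: "Y \<in> disc_class N D X \<longleftrightarrow> Y - X \<in> L"
proof -
  have "Y \<in> disc_class N D X \<longleftrightarrow> (\<exists>h\<in>L. Y = h + X)"
    by (simp add: disc_class_def r_coset_def G_simps)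
  also have "\<dots> \<longleftrightarrow> Y - X \<in> L"
    by (metis add_diff_cancel diff_add_cancel)
  finally show ?thesis .
qed

lemma disc_class_eq_iff: "disc_class N D X = disc_class N D Y \<longleftrightarrow> X - Y \<in> L"
proof
  assume "disc_class N D X = disc_class N D Y"
  moreover have "X \<in> disc_class N D X" by (simp add: mem_disc_class L_closed)
  ultimately show "X - Y \<in> L" by (simp add: mem_disc_class)
next
  assume XY: "X - Y \<in> L"
  have "Z - X \<in> L \<longleftrightarrow> Z - Y \<in> L" for Z
    using L_closed(3) [OF _ XY, of "Z - X"] L_closed(4) [OF _ XY, of "Z - Y"] by auto
  then show "disc_class N D X = disc_class N D Y" by (auto simp: mem_disc_class)
qed

text \<open>Each \<open>W a b c\<close> is a union of cosets of L, so a subgroup of the discriminant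
  group can be recovered from its pre-image.\<close>

lemma Union_disc_class_W: "\<Union> (disc_class N D ` W a b c) = W a b c"
proof (intro equalityI subsetI)
  fix X assume "X \<in> \<Union> (disc_class N D ` W a b c)"
  then obtain Y where Y: "Y \<in> W a b c" "X - Y \<in> L" by (auto simp: mem_disc_class)
  then have "X - Y \<in> W a b c" using W_1_subset by (auto simp: lattice_L_eq)
  then show "X \<in> W a b c" using W_closed(3) [OF _ Y(1)] by fastforce
next
  fix X assume "X \<in> W a b c"
  moreover have "X \<in> disc_class N D X" by (simp add: mem_disc_class L_closed)
  ultimately show "X \<in> \<Union> (disc_class N D ` W a b c)" by blast
qed

lemma carrier_disc_group: "carrier (disc_group N D) = disc_class N D ` W (2 * M) D D"
  by (auto simp: disc_group_def FactGroup_def RCOSETS_def disc_class_def G_simps)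

lemma generate_disc_class:
  assumes "X \<in> W (2 * M) D D"
  shows "generate (disc_group N D) {disc_class N D X} = range (\<lambda>n::int. disc_class N D (of_int n *\<^sub>R X))"
proof -
  have "group (disc_group N D)"
    unfolding disc_group_def by (rule normal.factorgroup_is_group [OF L_normal])
  moreover have "disc_class N D X [^]\<^bsub>disc_group N D\<^esub> (n :: int) = disc_class N D (of_int n *\<^sub>R X)" for n
    using normal.FactGroup_int_pow [OF L_normal, of X n] assms
    unfolding disc_group_def disc_class_def by (simp add: G_simps int_pow_G)
  moreover have "disc_class N D X \<in> carrier (disc_group N D)"
    using assms by (auto simp: carrier_disc_group)
  ultimately show ?thesis by (auto simp: group.generate_pow)
qed

text \<open>Identifies a cyclic subgroup by its pre-image: the last hypothesis says that modulo L
  every vector of the pre-image is an integral multiple of the generator.\<close>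

lemma generate_disc_class_eq_W:
  assumes "lv k i j \<in> W (2 * M) D D" "lv k i j \<in> W a b c"
    and "\<And>X. X \<in> W a b c \<Longrightarrow> \<exists>n::int. X - of_int n *\<^sub>R lv k i j \<in> L"
  shows "generate (disc_group N D) {disc_class N D (lv k i j)} = disc_class N D ` W a b c"
proof -
  have "of_int n *\<^sub>R lv k i j \<in> W a b c" for n
    using assms(2) by (simp add: lv_scaleR lv_in_W_iff mult.left_commute)
  then show ?thesis
    unfolding generate_disc_class [OF assms(1)] using assms(3) disc_class_eq_iff by fast
qed

section \<open>The subgroups of the discriminant group and their pre-images\<close>

lemma disc_H_eq: "disc_H N D = disc_class N D ` W (2 * M) (Suc 0) (Suc 0)"
proof -
  have "(sqrt (real D) / (2 * sqrt (real N))) *\<^sub>R mat_H = lv (1 / (2 * M)) 0 0"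
    using M_pos D_pos
    by (simp add: mat_H_def lv_def mat2_scaleR N_eq real_sqrt_mult field_simps)
  then show ?thesis
    unfolding disc_H_def
  proof (simp only:, intro generate_disc_class_eq_W)
    fix X assume "X \<in> W (2 * M) (Suc 0) (Suc 0)"
    then obtain k i j :: real where X: "X = lv k i j" "real (2 * M) * k \<in> \<int>" "i \<in> \<int>" "j \<in> \<int>"
      by (auto elim: W_cases)
    from X(2) obtain n where "real (2 * M) * k = of_int n" by (rule Ints_cases)
    then have "k = of_int n * (1 / (2 * M))" using M_pos by (simp add: field_simps)
    then show "\<exists>n::int. X - of_int n *\<^sub>R lv (1 / (2 * M)) 0 0 \<in> L"
      using X by (intro exI [of _ n]) (simp add: lv_scaleR lv_diff lattice_L_eq lv_in_W_iff)
  qed (use M_pos in \<open>auto simp: lv_in_W_iff\<close>)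
qed

lemma disc_E_eq: "disc_E N D = disc_class N D ` W (Suc 0) D (Suc 0)"
proof -
  have "(1 / sqrt (real D * real N)) *\<^sub>R mat_E = lv 0 (1 / D) 0"
    using M_pos D_pos
    by (simp add: mat_E_def lv_def mat2_scaleR N_eq real_sqrt_mult field_simps)
  then show ?thesis
    unfolding disc_E_def
  proof (simp only:, intro generate_disc_class_eq_W)
    fix X assume "X \<in> W (Suc 0) D (Suc 0)"
    then obtain k i j :: real where X: "X = lv k i j" "k \<in> \<int>" "D * i \<in> \<int>" "j \<in> \<int>"
      by (auto elim: W_cases)
    from X(3) obtain n where "D * i = of_int n" by (rule Ints_cases)
    then have "i = of_int n * (1 / D)" using D_pos by (simp add: field_simps)
    then show "\<exists>n::int. X - of_int n *\<^sub>R lv 0 (1 / D) 0 \<in> L"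
      using X by (intro exI [of _ n]) (simp add: lv_scaleR lv_diff lattice_L_eq lv_in_W_iff)
  qed (use D_pos in \<open>auto simp: lv_in_W_iff\<close>)
qed

lemma disc_F_eq: "disc_F N D = disc_class N D ` W (Suc 0) (Suc 0) D"
proof -
  have "(sqrt (real N) / sqrt (real D)) *\<^sub>R mat_F = lv 0 0 (1 / D)"
    using M_pos D_pos
    by (simp add: mat_F_def lv_def mat2_scaleR N_eq real_sqrt_mult field_simps)
  then show ?thesis
    unfolding disc_F_def
  proof (simp only:, intro generate_disc_class_eq_W)
    fix X assume "X \<in> W (Suc 0) (Suc 0) D"
    then obtain k i j :: real where X: "X = lv k i j" "k \<in> \<int>" "i \<in> \<int>" "D * j \<in> \<int>"
      by (auto elim: W_cases)
    from X(4) obtain n where "D * j = of_int n" by (rule Ints_cases)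
    then have "j = of_int n * (1 / D)" using D_pos by (simp add: field_simps)
    then show "\<exists>n::int. X - of_int n *\<^sub>R lv 0 0 (1 / D) \<in> L"
      using X by (intro exI [of _ n]) (simp add: lv_scaleR lv_diff lattice_L_eq lv_in_W_iff)
  qed (use D_pos in \<open>auto simp: lv_in_W_iff\<close>)
qed

lemma disc_EF_eq: "disc_EF N D = disc_class N D ` W (Suc 0) D D"
proof -
  have sub: "W (Suc 0) D (Suc 0) \<subseteq> W (2 * M) D D" "W (Suc 0) (Suc 0) D \<subseteq> W (2 * M) D D"
    by (auto simp: lv_in_W_iff elim!: W_cases)
  have mult: "disc_class N D X \<otimes>\<^bsub>disc_group N D\<^esub> disc_class N D Y = disc_class N D (X + Y)"
    if "X \<in> W (2 * M) D D" "Y \<in> W (2 * M) D D" for X Y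
    using normal.rcos_sum [OF L_normal] that
    by (simp add: disc_group_def FactGroup_def disc_class_def G_simps)
  have "disc_EF N D = (\<Union>X\<in>W (Suc 0) D (Suc 0). \<Union>Y\<in>W (Suc 0) (Suc 0) D.
      {disc_class N D X \<otimes>\<^bsub>disc_group N D\<^esub> disc_class N D Y})"
    unfolding disc_EF_def disc_E_eq disc_F_eq set_mult_def by blast
  also have "\<dots> = (\<Union>X\<in>W (Suc 0) D (Suc 0). \<Union>Y\<in>W (Suc 0) (Suc 0) D. {disc_class N D (X + Y)})"
    using mult sub by (intro SUP_cong refl) blast
  also have "\<dots> = disc_class N D ` W (Suc 0) D D"
  proof (intro equalityI subsetI)
    fix C assume "C \<in> disc_class N D ` W (Suc 0) D D"
    then obtain k i j :: real where C: "C = disc_class N D (lv k i j)" "k \<in> \<int>" "D * i \<in> \<int>" "D * j \<in> \<int>"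
      by (auto elim: W_cases)
    have "lv k i j = lv k i 0 + lv 0 0 j" by (simp add: lv_add)
    moreover have "lv k i 0 \<in> W (Suc 0) D (Suc 0)" "lv 0 0 j \<in> W (Suc 0) (Suc 0) D"
      using C by (simp_all add: lv_in_W_iff)
    ultimately show "C \<in> (\<Union>X\<in>W (Suc 0) D (Suc 0). \<Union>Y\<in>W (Suc 0) (Suc 0) D. {disc_class N D (X + Y)})"
      using C(1) by auto
  qed (auto simp: lv_add lv_in_W_iff distrib_left elim!: W_cases)
  finally show ?thesis .
qed

text \<open>The generator of the H-part has first coordinate 1/(2M), so pairing with it returns
  exactly the coordinate k of X; integrality of k characterizes the pre-image of E + F.\<close>

lemma disc_orth_disc_H: "disc_orth N D (disc_H N D) = disc_EF N D"
proof (intro equalityI subsetI)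
  fix C assume C: "C \<in> disc_orth N D (disc_H N D)"
  then obtain X where X: "X \<in> W (2 * M) D D" "C = disc_class N D X"
    by (auto simp: disc_orth_def carrier_disc_group)
  from X(1) obtain k i j :: real where X_eq: "X = lv k i j" "D * i \<in> \<int>" "D * j \<in> \<int>"
    by (auto elim: W_cases)
  define Y where "Y = lv (1 / (2 * M)) 0 0"
  have self: "Z \<in> disc_class N D Z" for Z by (simp add: mem_disc_class L_closed)
  have "Y \<in> W (2 * M) (Suc 0) (Suc 0)" using M_pos by (simp add: Y_def lv_in_W_iff)
  then have "bform X Y \<in> \<int>" using C X(2) self by (auto simp: disc_orth_def disc_H_eq)
  then have "k \<in> \<int>" using M_pos by (simp add: X_eq Y_def bform_lv)
  then have "X \<in> W (Suc 0) D D" using X_eq by (simp add: lv_in_W_iff)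
  then show "C \<in> disc_EF N D" using X(2) by (simp add: disc_EF_eq)
next
  fix C assume "C \<in> disc_EF N D"
  then have C: "C \<in> disc_class N D ` W (Suc 0) D D" by (simp add: disc_EF_eq)
  have "W (Suc 0) D D \<subseteq> W (2 * M) D D" by (auto simp: lv_in_W_iff elim!: W_cases)
  then have carr: "C \<in> carrier (disc_group N D)" using C by (auto simp: carrier_disc_group)
  have "bform X Y \<in> \<int>" if "X \<in> C" "Y \<in> C'" "C' \<in> disc_H N D" for X Y C'
  proof -
    have "X \<in> W (Suc 0) D D" "Y \<in> W (2 * M) (Suc 0) (Suc 0)"
      using that C Union_disc_class_W unfolding disc_H_eq by blast+
    then obtain k i j k' i' j' :: real where XY: "X = lv k i j" "Y = lv k' i' j'"
      "k \<in> \<int>" "D * i \<in> \<int>" "D * j \<in> \<int>" "real (2 * M) * k' \<in> \<int>" "i' \<in> \<int>" "j' \<in> \<int>"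
      by (auto elim!: W_cases)
    have "bform X Y = k * (real (2 * M) * k') + ((D * i) * j' + (D * j) * i')"
      by (simp add: XY bform_lv algebra_simps)
    then show ?thesis using XY by simp
  qed
  then show "C \<in> disc_orth N D (disc_H N D)" using carr by (auto simp: disc_orth_def)
qed

section \<open>The action on cosets of L\<close>

lemma disc_act_disc_class:
  assumes "conj_act A ` L = L"
  shows "disc_act A (disc_class N D X) = disc_class N D (conj_act A X)"
proof (intro equalityI subsetI)
  fix Y assume "Y \<in> disc_act A (disc_class N D X)"
  then show "Y \<in> disc_class N D (conj_act A X)"
    using assms by (auto simp: disc_act_def mem_disc_class simp flip: conj_act_diff)
next
  fix Y assume "Y \<in> disc_class N D (conj_act A X)"
  then have "Y - conj_act A X \<in> conj_act A ` L" using assms by (simp add: mem_disc_class)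
  then obtain Z where Z: "Z \<in> L" "Y - conj_act A X = conj_act A Z" by blast
  then have "Y = conj_act A (Z + X)" by (simp add: conj_act_add algebra_simps)
  then show "Y \<in> disc_act A (disc_class N D X)"
    using Z(1) by (auto simp: disc_act_def mem_disc_class)
qed

text \<open>Unions commute with images, so invariance of a set of cosets can be read off from the
  invariance of its union and conversely.\<close>

lemma disc_stabilizer_eq:
  "disc_stabilizer N D (disc_class N D ` W a b c) = {A \<in> SAut_plus L. conj_act A ` W a b c = W a b c}"
proof -
  have "disc_act A ` disc_class N D ` W a b c = disc_class N D ` W a b c \<longleftrightarrow> conj_act A ` W a b c = W a b c"
    if "conj_act A ` L = L" for A
  proof
    assume "disc_act A ` disc_class N D ` W a b c = disc_class N D ` W a b c"
    then have "\<Union> (disc_act A ` disc_class N D ` W a b c) = W a b c"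
      by (simp add: Union_disc_class_W)
    moreover have "\<Union> (disc_act A ` disc_class N D ` W a b c) = conj_act A ` \<Union> (disc_class N D ` W a b c)"
      unfolding disc_act_def by blast
    ultimately show "conj_act A ` W a b c = W a b c" by (simp add: Union_disc_class_W)
  next
    assume *: "conj_act A ` W a b c = W a b c"
    have "disc_act A ` disc_class N D ` W a b c = disc_class N D ` conj_act A ` W a b c"
      by (simp add: image_image disc_act_disc_class [OF that])
    then show "disc_act A ` disc_class N D ` W a b c = disc_class N D ` W a b c" by (simp add: *)
  qed
  then show ?thesis by (simp add: disc_stabilizer_def SAut_plus_def cong: conj_cong)
qed

lemma disc_fixer_eq:
  "disc_fixer N D (disc_class N D ` W a b c) =
     {A \<in> SAut_plus L. \<forall>X\<in>W a b c. conj_act A X - X \<in> L}"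
proof -
  have "(\<forall>C\<in>disc_class N D ` W a b c. disc_act A C = C) \<longleftrightarrow> (\<forall>X\<in>W a b c. conj_act A X - X \<in> L)"
    if "conj_act A ` L = L" for A
    by (simp add: disc_act_disc_class [OF that] disc_class_eq_iff)
  then show ?thesis by (simp add: disc_fixer_def SAut_plus_def cong: conj_cong)
qed

end

subsection \<open>Stabilizers and the integral case\<close>

lemma Ints_divide_iff_dvd:
  assumes "n > 0"
  shows "of_int x / real n \<in> \<int> \<longleftrightarrow> int n dvd x"
proof
  assume "of_int x / real n \<in> \<int>"
  then obtain z where "of_int x / real n = of_int z" by (rule Ints_cases)
  then have "real_of_int x = of_int (z * int n)" using assms by (simp add: field_simps)
  then have "x = z * int n" by (simp only: of_int_eq_iff)
  then show "int n dvd x" by simp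
next
  assume "int n dvd x"
  then obtain z where "x = int n * z" ..
  then show "of_int x / real n \<in> \<int>" using assms by simp
qed

lemma level_cond_dvd:
  assumes "level_cond N g p q r s" "g dvd h"
  shows "level_cond N h p q r s"
  using assms Ints_mult_dvd unfolding level_cond_def by blast

lemma presentation_of_int_iff:
  "presentation N (mat2 p q r s) \<mu> (of_int a) (of_int b) (of_int c) (of_int d) \<longleftrightarrow>
     exact_divisor \<mu> N \<and> p = of_int a * sqrt (real \<mu>) \<and> q = of_int b / sqrt (real \<mu>) \<and>
     r = of_int c * (real N / real \<mu>) * sqrt (real \<mu>) \<and> s = of_int d * sqrt (real \<mu>)"
  by (auto simp: presentation_def frac_ints_def)

text \<open>Recovers \<mu> from the matrix alone: ad\<mu> is ps, so \<mu> = gcd(N, ps). The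
  determinant makes \<nu> coprime to ad.\<close>

lemma exact_divisor_eq_gcd:
  fixes a b c d :: int
  assumes "a * d * int \<mu> - b * c * int \<nu> = 1"
  shows "gcd (int (\<mu> * \<nu>)) (a * d * int \<mu>) = int \<mu>"
proof -
  have "coprime (int \<nu>) (a * d)"
  proof (rule coprimeI)
    fix x assume "x dvd int \<nu>" "x dvd a * d"
    then have "x dvd a * d * int \<mu> - b * c * int \<nu>" by simp
    then show "is_unit x" by (simp add: assms)
  qed
  then show ?thesis
    by (simp add: mult.commute [of "a * d"] gcd_mult_left)
qed

text \<open>Existence comes from level 1, uniqueness of \<mu> from its expression as gcd(N, ps);
  together they give the definite description in \<open>assoc_divisor\<close> its value.\<close>

lemma integral_presentation:
  assumes N: "N > 0" and L: "level_cond N (Suc 0) p q r s"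
  obtains \<mu> \<nu> :: nat and a b c d :: int where
    "N = \<mu> * \<nu>" "coprime \<mu> \<nu>" "\<mu> > 0" "\<nu> > 0" "assoc_divisor N (mat2 p q r s) = \<mu>"
    "a * d * int \<mu> - b * c * int \<nu> = 1"
    "p = of_int a * sqrt (real \<mu>)" "q = of_int b / sqrt (real \<mu>)"
    "r = of_int c * real \<nu> * sqrt (real \<mu>)" "s = of_int d * sqrt (real \<mu>)"
proof -
  let ?P = "\<lambda>\<mu>. \<exists>a\<in>\<int>. \<exists>b\<in>\<int>. \<exists>c\<in>\<int>. \<exists>d\<in>\<int>. presentation N (mat2 p q r s) \<mu> a b c d"
  have det: "p * s - q * r = 1" using L by (simp add: level_cond_def)
  have *: "\<exists>a b c d::int. N = \<mu> * (N div \<mu>) \<and> coprime \<mu> (N div \<mu>) \<and> \<mu> > 0 \<and> N div \<mu> > 0 \<and>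
      a * d * int \<mu> - b * c * int (N div \<mu>) = 1 \<and>
      p = of_int a * sqrt (real \<mu>) \<and> q = of_int b / sqrt (real \<mu>) \<and>
      r = of_int c * real (N div \<mu>) * sqrt (real \<mu>) \<and> s = of_int d * sqrt (real \<mu>)" if "?P \<mu>" for \<mu>
  proof -
    from that obtain a b c d :: int where
      "presentation N (mat2 p q r s) \<mu> (of_int a) (of_int b) (of_int c) (of_int d)"
      by (auto elim!: Ints_cases)
    then have ed: "exact_divisor \<mu> N" and eqs: "p = of_int a * sqrt (real \<mu>)" "q = of_int b / sqrt (real \<mu>)"
       "r = of_int c * (real N / real \<mu>) * sqrt (real \<mu>)" "s = of_int d * sqrt (real \<mu>)"
      by (simp_all add: presentation_of_int_iff)
    define \<nu> where "\<nu> = N div \<mu>"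
    have mn: "N = \<mu> * \<nu>" "coprime \<mu> \<nu>" using ed by (auto simp: exact_divisor_def \<nu>_def)
    then have pos: "\<mu> > 0" "\<nu> > 0" using N by auto
    have r: "r = of_int c * real \<nu> * sqrt (real \<mu>)" using eqs(3) mn pos by simp
    have "real_of_int (a * d * int \<mu> - b * c * int \<nu>) = of_int 1"
      using det pos unfolding eqs(1,2,4) r by (simp add: field_simps)
    then have "a * d * int \<mu> - b * c * int \<nu> = 1" by (simp only: of_int_eq_iff)
    then show ?thesis using mn pos eqs r \<nu>_def by metis
  qed
  have uniq: "\<mu> = \<mu>'" if "?P \<mu>" "?P \<mu>'" for \<mu> \<mu>'
  proof -
    from * [OF that(1)] obtain a b c d :: int where 1: "N = \<mu> * (N div \<mu>)"
      "a * d * int \<mu> - b * c * int (N div \<mu>) = 1" "p = of_int a * sqrt (real \<mu>)" "s = of_int d * sqrt (real \<mu>)"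
      by blast
    from * [OF that(2)] obtain a' b' c' d' :: int where 2: "N = \<mu>' * (N div \<mu>')"
      "a' * d' * int \<mu>' - b' * c' * int (N div \<mu>') = 1" "p = of_int a' * sqrt (real \<mu>')" "s = of_int d' * sqrt (real \<mu>')"
      by blast
    have "p * s = of_int (a * d * int \<mu>)" using 1(3,4) by simp
    moreover have "p * s = of_int (a' * d' * int \<mu>')" using 2(3,4) by simp
    ultimately have "a * d * int \<mu> = a' * d' * int \<mu>'" by (metis of_int_eq_iff)
    then show ?thesis
      using exact_divisor_eq_gcd [OF 1(2)] exact_divisor_eq_gcd [OF 2(2)] 1(1) 2(1)
      by (metis of_nat_eq_iff)
  qed
  have "mat2 p q r s \<in> Gamma0_star_sigma N 1"
    using L N by (simp add: Gamma0_star_sigma_iff)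
  then have "\<exists>\<mu>. ?P \<mu>"
    unfolding Gamma0_star_sigma_def by (simp add: frac_ints_def) blast
  then obtain \<mu> where mu: "?P \<mu>" ..
  then have "assoc_divisor N (mat2 p q r s) = \<mu>"
    unfolding assoc_divisor_def by (rule the_equality) (rule uniq [OF _ mu])
  then show thesis using * [OF mu] that by blast
qed

text \<open>If k divides v\<nu>, a common divisor of \<mu> and k divides u\<mu> - v\<nu> = 1.
  Conversely a divisor k of \<mu>\<nu> coprime to \<mu> divides \<nu>.\<close>

lemma dvd_iff_coprime_exact_divisor:
  fixes u :: int
  assumes "u * int \<mu> - v * int \<nu> = 1" "k dvd \<mu> * \<nu>"
  shows "int k dvd v * int \<nu> \<longleftrightarrow> coprime \<mu> k"
proof
  assume k: "int k dvd v * int \<nu>"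
  have "coprime (int \<mu>) (int k)"
  proof (rule coprimeI)
    fix x assume "x dvd int \<mu>" "x dvd int k"
    then have "x dvd u * int \<mu> - v * int \<nu>" using k by (meson dvd_diff dvd_mult dvd_trans)
    then show "is_unit x" by (simp add: assms)
  qed
  then show "coprime \<mu> k" by simp
next
  assume "coprime \<mu> k"
  then have "k dvd \<nu>" using assms(2) by (simp add: coprime_commute coprime_dvd_mult_right_iff)
  then show "int k dvd v * int \<nu>" by simp
qed

text \<open>The determinant makes \<mu> coprime to c\<nu>, hence also to c^2 \<nu>, so squaring c
  does not change the criterion.\<close>

lemma dvd_square_iff_coprime_exact_divisor:
  fixes a b c d :: int
  assumes "a * d * int \<mu> - b * c * int \<nu> = 1" "k dvd \<mu> * \<nu>"
  shows "int k dvd c\<^sup>2 * int \<nu> \<longleftrightarrow> coprime \<mu> k"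
proof
  assume k: "int k dvd c\<^sup>2 * int \<nu>"
  have "coprime (int \<mu>) (c * int \<nu>)"
  proof (rule coprimeI)
    fix x assume "x dvd int \<mu>" "x dvd c * int \<nu>"
    then have "x dvd (a * d) * int \<mu> - b * (c * int \<nu>)" by (meson dvd_diff dvd_mult)
    then show "is_unit x" by (simp add: assms flip: mult.assoc)
  qed
  then have "coprime (int \<mu>) (c\<^sup>2 * int \<nu>)" by simp
  then have "coprime (int \<mu>) (int k)" by (rule coprime_divisors [OF dvd_refl k])
  then show "coprime \<mu> k" by simp
next
  assume "coprime \<mu> k"
  then have "k dvd \<nu>" using assms(2) by (simp add: coprime_commute coprime_dvd_mult_right_iff)
  then show "int k dvd c\<^sup>2 * int \<nu>" by simp
qed

lemma Gamma0_iff: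
  "mat2 p q r s \<in> Gamma0 N \<longleftrightarrow> (\<exists>a b c d :: int. p = of_int a \<and> q = of_int b \<and>
     r = of_int (c * int N) \<and> s = of_int d \<and> a * d - b * c * int N = 1)"
  unfolding Gamma0_def mem_Collect_eq mat2_eq_iff
proof (intro iffI; elim exE conjE)
  fix a b c d :: int
  assume *: "p = of_int a" "q = of_int b" "r = of_int c" "s = of_int d" "a * d - b * c = 1" "int N dvd c"
  then obtain k where "c = int N * k" by blast
  then show "\<exists>a b c d :: int. p = of_int a \<and> q = of_int b \<and>
     r = of_int (c * int N) \<and> s = of_int d \<and> a * d - b * c * int N = 1"
    using * by (intro exI [of _ a] exI [of _ b] exI [of _ k] exI [of _ d]) (simp add: mult_ac)
next
  fix a b c d :: int
  assume *: "p = of_int a" "q = of_int b" "r = of_int (c * int N)" "s = of_int d" "a * d - b * c * int N = 1"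
  then show "\<exists>a b c d :: int. (p = of_int a \<and> q = of_int b \<and> r = of_int c \<and> s = of_int d) \<and>
     a * d - b * c = 1 \<and> int N dvd c"
    by (intro exI [of _ a] exI [of _ b] exI [of _ "c * int N"] exI [of _ d]) (simp add: mult_ac)
qed

context disc_lattice
begin

section \<open>Automorphisms, stabilizers and fixers as integrality conditions\<close>

lemma scaled_entries:
  fixes x :: real
  shows "D * (x / N) = x / M" "real (2 * M) * (x / N) = 2 * x / D" "x / D / M = x / N"
  using D_pos M_pos by (simp_all add: N_eq)

text \<open>Each mixed product is cleared by both D and 2M: pr/M and 2pr/D are D and 2M times pr/N.
  Bezout merges the two conditions into one for the gcd.\<close>

lemma SAut_plus_iff: "mat2 p q r s \<in> SAut_plus L \<longleftrightarrow> level_cond N (gcd D (2 * M)) p q r s"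
proof (cases "p * s - q * r = 1")
  case True
  have base: "mat2 p q r s \<in> SAut_plus L \<longleftrightarrow>
    p * s + q * r \<in> \<int> \<and> p\<^sup>2 \<in> \<int> \<and> s\<^sup>2 \<in> \<int> \<and> N * q\<^sup>2 \<in> \<int> \<and> r\<^sup>2 / N \<in> \<int> \<and>
    D * (p * q) \<in> \<int> \<and> D * (s * q) \<in> \<int> \<and> p * r / M \<in> \<int> \<and> s * r / M \<in> \<int> \<and>
    real (2 * M) * (p * q) \<in> \<int> \<and> real (2 * M) * (s * q) \<in> \<int> \<and> 2 * (p * r) / D \<in> \<int> \<and> 2 * (s * r) / D \<in> \<int>"
    unfolding SAut_plus_def mem_Collect_eq mat2_SL2R_iff lattice_L_eq
    by (simp add: conj_act_W_eq_iff [OF True] True) (auto simp: mult_ac)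
  show ?thesis
  proof
    assume A: "mat2 p q r s \<in> SAut_plus L"
    \<comment> \<open>Conjugation only controls ps + qr = 2ps - 1; the factor 2 is removed by
      integrality of p^2 s^2 and rationality of ps.\<close>
    have "2 * (p * s) = 1 + (p * s + q * r)" using True by simp
    then have two: "2 * (p * s) \<in> \<int>" using A base by (metis Ints_1 Ints_add)
    have "p * s = (2 * (p * s)) / 2" by simp
    then have "p * s \<in> \<rat>" using two by (metis Ints_subset_Rats Rats_divide Rats_number_of subsetD)
    moreover have "(p * s)\<^sup>2 \<in> \<int>" using A base by (simp add: power_mult_distrib)
    ultimately have "p * s \<in> \<int>" by (rule square_of_Rats_Ints)
    moreover have "real (gcd D (2 * M)) * (p * q) \<in> \<int>" "real (gcd D (2 * M)) * (s * q) \<in> \<int>"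
      "real (gcd D (2 * M)) * (p * r / N) \<in> \<int>" "real (gcd D (2 * M)) * (s * r / N) \<in> \<int>"
      using A base scaled_entries by (intro Ints_nat_gcd_mult; simp)+
    ultimately show "level_cond N (gcd D (2 * M)) p q r s"
      using True A base by (simp add: level_cond_def)
  next
    assume L: "level_cond N (gcd D (2 * M)) p q r s"
    have "p * s + q * r = 2 * (p * s) - 1" using True by simp
    then have "p * s + q * r \<in> \<int>" using L by (simp add: level_cond_def)
    then show "mat2 p q r s \<in> SAut_plus L"
      using level_cond_dvd [OF L gcd_dvd1] level_cond_dvd [OF L gcd_dvd2]
      unfolding base level_cond_def scaled_entries by simp
  qed
qed (simp add: level_cond_def SAut_plus_def mat2_SL2R_iff)

lemma level_cond_1_imp_SAut_plus: "level_cond N (Suc 0) p q r s \<Longrightarrow> mat2 p q r s \<in> SAut_plus L"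
  for p q r s :: real
  unfolding SAut_plus_iff by (erule level_cond_dvd) simp

lemma SAut_plus_E:
  fixes p q r s :: real
  assumes "mat2 p q r s \<in> SAut_plus L"
  shows "p * s - q * r = 1" "p * s \<in> \<int>" "q * r \<in> \<int>" "p\<^sup>2 \<in> \<int>" "s\<^sup>2 \<in> \<int>" "N * q\<^sup>2 \<in> \<int>" "r\<^sup>2 / N \<in> \<int>"
proof -
  show *: "p * s - q * r = 1" "p * s \<in> \<int>" "p\<^sup>2 \<in> \<int>" "s\<^sup>2 \<in> \<int>" "N * q\<^sup>2 \<in> \<int>" "r\<^sup>2 / N \<in> \<int>"
    using assms unfolding SAut_plus_iff level_cond_def by simp_all
  have "q * r = p * s - 1" using *(1) by simp
  then show "q * r \<in> \<int>" using *(2) by simp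
qed

lemma level_cond_1_iff:
  "level_cond N (Suc 0) p q r s \<longleftrightarrow> mat2 p q r s \<in> SAut_plus L \<and>
     p * q \<in> \<int> \<and> s * q \<in> \<int> \<and> p * r / N \<in> \<int> \<and> s * r / N \<in> \<int>"
proof
  assume L: "level_cond N (Suc 0) p q r s"
  then show "mat2 p q r s \<in> SAut_plus L \<and>
     p * q \<in> \<int> \<and> s * q \<in> \<int> \<and> p * r / N \<in> \<int> \<and> s * r / N \<in> \<int>"
    using level_cond_1_imp_SAut_plus [OF L] by (simp add: level_cond_def)
next
  assume A: "mat2 p q r s \<in> SAut_plus L \<and>
     p * q \<in> \<int> \<and> s * q \<in> \<int> \<and> p * r / N \<in> \<int> \<and> s * r / N \<in> \<int>"
  then have "mat2 p q r s \<in> SAut_plus L" ..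
  from SAut_plus_E [OF this] A show "level_cond N (Suc 0) p q r s"
    by (simp add: level_cond_def)
qed

text \<open>The remaining two products are integral combinations of \<open>p * q\<close> and \<open>s * r / N\<close>
  because of \<open>p * s - q * r = 1\<close>.\<close>

lemma level_cond_1I:
  fixes p q r s :: real
  assumes A: "mat2 p q r s \<in> SAut_plus L" and "p * q \<in> \<int>" "s * r / N \<in> \<int>"
  shows "level_cond N (Suc 0) p q r s"
proof -
  note E = SAut_plus_E [OF A]
  have "s * q = s * q * (p * s - q * r)" using E by simp
  also have "\<dots> = s\<^sup>2 * (p * q) - (N * q\<^sup>2) * (s * r / N)"
    using N_pos by (simp add: power2_eq_square field_simps)
  also have "\<dots> \<in> \<int>" by (rule Ints_diff; rule Ints_mult; fact E assms)
  finally have sq: "s * q \<in> \<int>" .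
  have "p * r / N = p * r / N * (p * s - q * r)" using E by simp
  also have "\<dots> = p\<^sup>2 * (s * r / N) - (r\<^sup>2 / N) * (p * q)"
    using N_pos by (simp add: power2_eq_square field_simps)
  also have "\<dots> \<in> \<int>" by (rule Ints_diff; rule Ints_mult; fact E assms)
  finally have "p * r / N \<in> \<int>" .
  with sq show ?thesis unfolding level_cond_1_iff using assms by blast
qed

text \<open>Facts for the simplifier, in the exact shapes that arise after N is replaced by D * M;
  variants differing only in the order of factors are intended.\<close>

lemma level_cond_1_products:
  fixes p q r s :: real
  assumes "level_cond N (Suc 0) p q r s"
  shows "p * q \<in> \<int>" "q * p \<in> \<int>" "q * s \<in> \<int>" "s * q \<in> \<int>" "p * r \<in> \<int>" "r * p \<in> \<int>" "r * s \<in> \<int>" "s * r \<in> \<int>"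
    "p * r / (real M * real D) \<in> \<int>" "r * p / (real D * real M) \<in> \<int>"
    "s * r / (real M * real D) \<in> \<int>" "r * s / (real D * real M) \<in> \<int>"
    "p * r / real M \<in> \<int>" "s * r / real M \<in> \<int>" "r * p / real D \<in> \<int>" "r * s / real D \<in> \<int>"
    "2 * (r * p) / real D \<in> \<int>" "2 * (r * s) / real D \<in> \<int>"
    "q\<^sup>2 * real N \<in> \<int>" "q\<^sup>2 * (real D * real M) \<in> \<int>" "r\<^sup>2 / (real D * real M) \<in> \<int>"
    "p * s + q * r \<in> \<int>"
proof -
  note A = level_cond_1_imp_SAut_plus [OF assms]
  note E = SAut_plus_E [OF A]
  have P: "p * q \<in> \<int>" "s * q \<in> \<int>" "p * r / N \<in> \<int>" "s * r / N \<in> \<int>"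
    using assms unfolding level_cond_1_iff by blast+
  have "N * (p * r / N) \<in> \<int>" "N * (s * r / N) \<in> \<int>" 
    by (rule Ints_mult [OF Ints_of_nat P(3)], rule Ints_mult [OF Ints_of_nat P(4)])
  then have "p * r \<in> \<int>" "s * r \<in> \<int>" using N_pos by simp_all
  moreover have "D * (p * r / N) \<in> \<int>" "D * (s * r / N) \<in> \<int>" "M * (p * r / N) \<in> \<int>" "M * (s * r / N) \<in> \<int>"
    by (rule Ints_mult [OF Ints_of_nat P(3)] Ints_mult [OF Ints_of_nat P(4)])+
  moreover from this have "p * r / M \<in> \<int>" "s * r / M \<in> \<int>" "r * p / D \<in> \<int>" "r * s / D \<in> \<int>"
    using D_pos M_pos by (simp_all add: N_eq mult.commute)
  moreover from this have "2 * (r * p / D) \<in> \<int>" "2 * (r * s / D) \<in> \<int>"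
    by (metis Ints_mult Ints_numeral)+
  ultimately show "p * q \<in> \<int>" "q * p \<in> \<int>" "q * s \<in> \<int>" "s * q \<in> \<int>" "p * r \<in> \<int>" "r * p \<in> \<int>" "r * s \<in> \<int>" "s * r \<in> \<int>"
    "p * r / (real M * real D) \<in> \<int>" "r * p / (real D * real M) \<in> \<int>"
    "s * r / (real M * real D) \<in> \<int>" "r * s / (real D * real M) \<in> \<int>"
    "p * r / real M \<in> \<int>" "s * r / real M \<in> \<int>" "r * p / real D \<in> \<int>" "r * s / real D \<in> \<int>"
    "2 * (r * p) / real D \<in> \<int>" "2 * (r * s) / real D \<in> \<int>"
    "q\<^sup>2 * real N \<in> \<int>" "q\<^sup>2 * (real D * real M) \<in> \<int>" "r\<^sup>2 / (real D * real M) \<in> \<int>"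
    "p * s + q * r \<in> \<int>"
    using P E by (simp_all add: N_eq mult_ac)
qed

text \<open>Dividing the H-generator by 2M turns its coefficients 2Mpq and 2rs/D into pq and rs/N,
  which already force level 1.\<close>

lemma disc_stabilizer_H_iff:
  "mat2 p q r s \<in> disc_stabilizer N D (disc_H N D) \<longleftrightarrow> level_cond N (Suc 0) p q r s"
proof -
  have pos: "2 * M > 0" "Suc 0 > 0" "Suc 0 > 0" using M_pos by simp_all
  show ?thesis
  proof
    assume "mat2 p q r s \<in> disc_stabilizer N D (disc_H N D)"
    then have A: "mat2 p q r s \<in> SAut_plus L"
      and W: "conj_act (mat2 p q r s) ` W (2 * M) (Suc 0) (Suc 0) = W (2 * M) (Suc 0) (Suc 0)"
      by (simp_all add: disc_H_eq disc_stabilizer_eq)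
    have "p * q \<in> \<int>" "s * r / N \<in> \<int>"
      using W pos D_pos unfolding conj_act_W_eq_iff [OF SAut_plus_E(1) [OF A] pos]
      by (simp_all add: N_eq mult_ac)
    then show "level_cond N (Suc 0) p q r s" by (rule level_cond_1I [OF A])
  next
    assume L: "level_cond N (Suc 0) p q r s"
    then have A: "mat2 p q r s \<in> SAut_plus L" by (rule level_cond_1_imp_SAut_plus)
    note E = SAut_plus_E [OF A]
    note P' = level_cond_1_products [OF L]
    have "conj_act (mat2 p q r s) ` W (2 * M) (Suc 0) (Suc 0) = W (2 * M) (Suc 0) (Suc 0)"
      unfolding conj_act_W_eq_iff [OF E(1) pos]
      using D_pos M_pos P' E by simp
    then show "mat2 p q r s \<in> disc_stabilizer N D (disc_H N D)"
      using A by (simp add: disc_H_eq disc_stabilizer_eq)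
  qed
qed

text \<open>Dividing the generators E and F by D turns Dqs and pr/M into qs and pr/N; with the
  inverse matrix all four products of level 1 appear directly.\<close>

lemma disc_stabilizer_EF_iff:
  "mat2 p q r s \<in> disc_stabilizer N D (disc_EF N D) \<longleftrightarrow> level_cond N (Suc 0) p q r s"
proof
  assume "mat2 p q r s \<in> disc_stabilizer N D (disc_EF N D)"
  then have A: "mat2 p q r s \<in> SAut_plus L"
    and W: "conj_act (mat2 p q r s) ` W (Suc 0) D D = W (Suc 0) D D"
    by (simp_all add: disc_EF_eq disc_stabilizer_eq)
  show "level_cond N (Suc 0) p q r s"
    unfolding level_cond_1_iff
    using A W D_pos unfolding conj_act_W_eq_iff [OF SAut_plus_E(1) [OF A] zero_less_Suc D_pos D_pos]
    by (simp add: N_eq mult_ac)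
next
  assume L: "level_cond N (Suc 0) p q r s"
  then have A: "mat2 p q r s \<in> SAut_plus L" by (rule level_cond_1_imp_SAut_plus)
  note E = SAut_plus_E [OF A]
  have "conj_act (mat2 p q r s) ` W (Suc 0) D D = W (Suc 0) D D"
    unfolding conj_act_W_eq_iff [OF E(1) zero_less_Suc D_pos D_pos]
    using D_pos M_pos level_cond_1_products [OF L] E by simp
  then show "mat2 p q r s \<in> disc_stabilizer N D (disc_EF N D)"
    using A by (simp add: disc_EF_eq disc_stabilizer_eq)
qed

text \<open>At level 1 the only remaining condition is that the E-generator divided by D has a
  conjugate with integral F-coordinate; the F-subgroup is symmetric.\<close>

lemma disc_stabilizer_E_iff:
  assumes "level_cond N (Suc 0) p q r s"
  shows "mat2 p q r s \<in> disc_stabilizer N D (disc_E N D) \<longleftrightarrow> r\<^sup>2 / (real N * real D) \<in> \<int>"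
proof -
  note A = level_cond_1_imp_SAut_plus [OF assms]
  note E = SAut_plus_E [OF A]
  have "mat2 p q r s \<in> disc_stabilizer N D (disc_E N D) \<longleftrightarrow>
      conj_act (mat2 p q r s) ` W (Suc 0) D (Suc 0) = W (Suc 0) D (Suc 0)"
    using A by (simp add: disc_E_eq disc_stabilizer_eq)
  also have "\<dots> \<longleftrightarrow> r\<^sup>2 / (real N * real D) \<in> \<int>"
    unfolding conj_act_W_eq_iff [OF E(1) zero_less_Suc D_pos zero_less_Suc]
    using D_pos M_pos level_cond_1_products [OF assms] E by (simp add: N_eq)
  finally show ?thesis .
qed

lemma disc_stabilizer_F_iff:
  assumes "level_cond N (Suc 0) p q r s"
  shows "mat2 p q r s \<in> disc_stabilizer N D (disc_F N D) \<longleftrightarrow> q\<^sup>2 * real N / real D \<in> \<int>"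
proof -
  note A = level_cond_1_imp_SAut_plus [OF assms]
  note E = SAut_plus_E [OF A]
  have "D * (r\<^sup>2 / N) \<in> \<int>" by (rule Ints_mult [OF Ints_of_nat E(7)])
  then have r: "r\<^sup>2 / real M \<in> \<int>" by (simp only: scaled_entries)
  have "mat2 p q r s \<in> disc_stabilizer N D (disc_F N D) \<longleftrightarrow>
      conj_act (mat2 p q r s) ` W (Suc 0) (Suc 0) D = W (Suc 0) (Suc 0) D"
    using A by (simp add: disc_F_eq disc_stabilizer_eq)
  also have "\<dots> \<longleftrightarrow> q\<^sup>2 * real N / real D \<in> \<int>"
    unfolding conj_act_W_eq_iff [OF E(1) zero_less_Suc zero_less_Suc D_pos]
    using D_pos M_pos level_cond_1_products [OF assms] E r by (simp add: N_eq)
  finally show ?thesis .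
qed

text \<open>With a = 2M the diagonal entry 2qr/a becomes qr/M, the one condition beyond stabilizing
  the H-subgroup.\<close>

lemma disc_fixer_H_iff:
  "mat2 p q r s \<in> disc_fixer N D (disc_H N D) \<longleftrightarrow> level_cond N (Suc 0) p q r s \<and> q * r / M \<in> \<int>"
proof -
  have pos: "2 * M > 0" "Suc 0 > 0" "Suc 0 > 0" using M_pos by simp_all
  have fixer: "mat2 p q r s \<in> disc_fixer N D (disc_H N D) \<longleftrightarrow> mat2 p q r s \<in> SAut_plus L \<and>
     (\<forall>X\<in>W (2 * M) (Suc 0) (Suc 0). conj_act (mat2 p q r s) X - X \<in> L)"
    by (simp add: disc_H_eq disc_fixer_eq)
  show ?thesis
  proof
    assume "mat2 p q r s \<in> disc_fixer N D (disc_H N D)"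
    then have A: "mat2 p q r s \<in> SAut_plus L"
      and W: "\<forall>X\<in>W (2 * M) (Suc 0) (Suc 0). conj_act (mat2 p q r s) X - X \<in> L"
      unfolding fixer by simp_all
    have "p * q \<in> \<int>" "s * r / N \<in> \<int>" "q * r / M \<in> \<int>"
      using W pos D_pos unfolding conj_act_fixes_W_iff [OF SAut_plus_E(1) [OF A] pos]
      by (simp_all add: N_eq mult_ac)
    then show "level_cond N (Suc 0) p q r s \<and> q * r / M \<in> \<int>" using level_cond_1I [OF A] by blast
  next
    assume L: "level_cond N (Suc 0) p q r s \<and> q * r / M \<in> \<int>"
    then have A: "mat2 p q r s \<in> SAut_plus L" by (blast intro: level_cond_1_imp_SAut_plus)
    have "\<forall>X\<in>W (2 * M) (Suc 0) (Suc 0). conj_act (mat2 p q r s) X - X \<in> L"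
      unfolding conj_act_fixes_W_iff [OF SAut_plus_E(1) [OF A] pos]
      using D_pos M_pos level_cond_1_products [OF conjunct1 [OF L]] L SAut_plus_E [OF A]
      by (simp add: N_eq)
    then show "mat2 p q r s \<in> disc_fixer N D (disc_H N D)" using A unfolding fixer by blast
  qed
qed

lemma disc_kernel_iff:
  "mat2 p q r s \<in> disc_kernel N D \<longleftrightarrow> level_cond N (Suc 0) p q r s \<and> q * r / M \<in> \<int> \<and>
     (p\<^sup>2 - 1) / real D \<in> \<int> \<and> (s\<^sup>2 - 1) / real D \<in> \<int> \<and> q\<^sup>2 * real N / real D \<in> \<int> \<and> r\<^sup>2 / (real N * real D) \<in> \<int>"
proof -
  have pos: "2 * M > 0" using M_pos by simp
  have fixer: "mat2 p q r s \<in> disc_kernel N D \<longleftrightarrow> mat2 p q r s \<in> SAut_plus L \<and>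
     (\<forall>X\<in>W (2 * M) D D. conj_act (mat2 p q r s) X - X \<in> L)"
    by (simp add: disc_kernel_def carrier_disc_group disc_fixer_eq)
  show ?thesis
  proof
    assume "mat2 p q r s \<in> disc_kernel N D"
    then have A: "mat2 p q r s \<in> SAut_plus L"
      and W: "\<forall>X\<in>W (2 * M) D D. conj_act (mat2 p q r s) X - X \<in> L"
      unfolding fixer by simp_all
    have "p * q \<in> \<int>" "s * r / N \<in> \<int>" "q * r / M \<in> \<int>" "(p\<^sup>2 - 1) / real D \<in> \<int>"
      "(s\<^sup>2 - 1) / real D \<in> \<int>" "q\<^sup>2 * real N / real D \<in> \<int>" "r\<^sup>2 / (real N * real D) \<in> \<int>"
      using W pos D_pos unfolding conj_act_fixes_W_iff [OF SAut_plus_E(1) [OF A] pos D_pos D_pos]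
      by (simp_all add: N_eq mult_ac)
    then show "level_cond N (Suc 0) p q r s \<and> q * r / M \<in> \<int> \<and>
     (p\<^sup>2 - 1) / real D \<in> \<int> \<and> (s\<^sup>2 - 1) / real D \<in> \<int> \<and> q\<^sup>2 * real N / real D \<in> \<int> \<and> r\<^sup>2 / (real N * real D) \<in> \<int>"
      using level_cond_1I [OF A] by blast
  next
    assume L: "level_cond N (Suc 0) p q r s \<and> q * r / M \<in> \<int> \<and>
     (p\<^sup>2 - 1) / real D \<in> \<int> \<and> (s\<^sup>2 - 1) / real D \<in> \<int> \<and> q\<^sup>2 * real N / real D \<in> \<int> \<and> r\<^sup>2 / (real N * real D) \<in> \<int>"
    then have A: "mat2 p q r s \<in> SAut_plus L" by (blast intro: level_cond_1_imp_SAut_plus)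
    have "\<forall>X\<in>W (2 * M) D D. conj_act (mat2 p q r s) X - X \<in> L"
      unfolding conj_act_fixes_W_iff [OF SAut_plus_E(1) [OF A] pos D_pos D_pos]
      using D_pos M_pos level_cond_1_products [OF conjunct1 [OF L]] L SAut_plus_E [OF A]
      by (simp add: N_eq)
    then show "mat2 p q r s \<in> disc_kernel N D" using A unfolding fixer by blast
  qed
qed

text \<open>In the integral presentation the three quotients are bc\<nu>/M, c^2 \<nu>/D and b^2
  \<nu>/D. The last two give the same criterion, as the determinant is symmetric in b and c.\<close>

lemma assoc_divisor_conditions:
  assumes "level_cond N (Suc 0) p q r s"
  shows "q * r / M \<in> \<int> \<longleftrightarrow> coprime (assoc_divisor N (mat2 p q r s)) M"
    "r\<^sup>2 / (real N * real D) \<in> \<int> \<longleftrightarrow> coprime (assoc_divisor N (mat2 p q r s)) D"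
    "q\<^sup>2 * real N / real D \<in> \<int> \<longleftrightarrow> coprime (assoc_divisor N (mat2 p q r s)) D"
proof -
  obtain \<mu> \<nu> :: nat and a b c d :: int where pres:
    "N = \<mu> * \<nu>" "coprime \<mu> \<nu>" "\<mu> > 0" "\<nu> > 0" "assoc_divisor N (mat2 p q r s) = \<mu>"
    "a * d * int \<mu> - b * c * int \<nu> = 1"
    "p = of_int a * sqrt (real \<mu>)" "q = of_int b / sqrt (real \<mu>)"
    "r = of_int c * real \<nu> * sqrt (real \<mu>)" "s = of_int d * sqrt (real \<mu>)"
    by (rule integral_presentation [OF N_pos assms])
  have dvd: "M dvd \<mu> * \<nu>" "D dvd \<mu> * \<nu>" unfolding pres(1) [symmetric] by (simp_all add: N_eq)
  have "q * r = of_int (b * c * int \<nu>)" using pres by simp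
  then have "q * r / M \<in> \<int> \<longleftrightarrow> int M dvd b * c * int \<nu>"
    by (simp only: Ints_divide_iff_dvd [OF M_pos])
  also have "\<dots> \<longleftrightarrow> coprime \<mu> M"
    by (rule dvd_iff_coprime_exact_divisor [OF pres(6) dvd(1)])
  finally show "q * r / M \<in> \<int> \<longleftrightarrow> coprime (assoc_divisor N (mat2 p q r s)) M" by (simp only: pres(5))
  have "r\<^sup>2 / (real N * real D) = of_int (c\<^sup>2 * int \<nu>) / real D"
    using pres(3,4) by (simp add: pres(1,9) power_mult_distrib power2_eq_square [of "real \<nu>"] field_simps)
  then have "r\<^sup>2 / (real N * real D) \<in> \<int> \<longleftrightarrow> int D dvd c\<^sup>2 * int \<nu>"
    by (simp only: Ints_divide_iff_dvd [OF D_pos])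
  also have "\<dots> \<longleftrightarrow> coprime \<mu> D"
    by (rule dvd_square_iff_coprime_exact_divisor [OF pres(6) dvd(2)])
  finally show "r\<^sup>2 / (real N * real D) \<in> \<int> \<longleftrightarrow> coprime (assoc_divisor N (mat2 p q r s)) D"
    by (simp only: pres(5))
  have det: "a * d * int \<mu> - c * b * int \<nu> = 1" using pres(6) by (simp add: mult_ac)
  have "q\<^sup>2 * real N / real D = of_int (b\<^sup>2 * int \<nu>) / real D"
    using pres(3,4) by (simp add: pres(1,8) power_divide)
  then have "q\<^sup>2 * real N / real D \<in> \<int> \<longleftrightarrow> int D dvd b\<^sup>2 * int \<nu>"
    by (simp only: Ints_divide_iff_dvd [OF D_pos])
  also have "\<dots> \<longleftrightarrow> coprime \<mu> D"
    by (rule dvd_square_iff_coprime_exact_divisor [OF det dvd(2)])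
  finally show "q\<^sup>2 * real N / real D \<in> \<int> \<longleftrightarrow> coprime (assoc_divisor N (mat2 p q r s)) D"
    by (simp only: pres(5))
qed

lemma Gamma0_imp_level_cond_1:
  assumes "mat2 p q r s \<in> Gamma0 N"
  shows "level_cond N (Suc 0) p q r s" "q * r / M \<in> \<int>" "q\<^sup>2 * real N / real D \<in> \<int>" "r\<^sup>2 / (real N * real D) \<in> \<int>"
proof -
  obtain a b c d :: int where eq: "p = of_int a" "q = of_int b" "r = of_int (c * int N)" "s = of_int d"
    and det: "a * d - b * c * int N = 1"
    using assms unfolding Gamma0_iff by blast
  have "real_of_int (a * d - b * c * int N) = of_int 1" by (simp only: det)
  then have "p * s - q * r = 1" by (simp add: eq)
  then show "level_cond N (Suc 0) p q r s"
    using N_pos by (simp add: level_cond_def eq power_mult_distrib power2_eq_square)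
  show "q * r / M \<in> \<int>" "q\<^sup>2 * real N / real D \<in> \<int>" "r\<^sup>2 / (real N * real D) \<in> \<int>"
    using M_pos D_pos by (simp_all add: eq N_eq power_mult_distrib power2_eq_square)
qed

text \<open>Since D | N, reduction modulo N does not affect the square modulo D.\<close>

lemma mod_in_square_trivial_units_iff:
  assumes "coprime a (int N)"
  shows "a mod int N \<in> square_trivial_units N D \<longleftrightarrow> (of_int a ^ 2 - 1) / real D \<in> \<int>"
proof -
  have "a mod int N \<in> square_trivial_units N D \<longleftrightarrow> [(a mod int N)\<^sup>2 = 1] (mod int D)"
    using assms N_pos by (simp add: square_trivial_units_def)
  also have "\<dots> \<longleftrightarrow> [a\<^sup>2 = 1] (mod int D)"
  proof -
    have "int D dvd int N" by (simp add: N_eq)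
    then have "a mod int N mod int D = a mod int D" by (rule mod_mod_cancel)
    then show ?thesis
      unfolding cong_def using power_mod [of "a mod int N" "int D" 2] power_mod [of a "int D" 2] by simp
  qed
  also have "\<dots> \<longleftrightarrow> int D dvd a\<^sup>2 - 1" by (simp add: cong_iff_dvd_diff)
  also have "\<dots> \<longleftrightarrow> of_int (a\<^sup>2 - 1) / real D \<in> \<int>" by (rule Ints_divide_iff_dvd [OF D_pos, symmetric])
  finally show ?thesis by simp
qed

text \<open>Fixing the H-part makes \<mu> coprime to M, and the entry linking E to F makes it
  coprime to D; being a divisor of N = DM, it is 1. What is left are the diagonal conditions p^2 =
  s^2 = 1 modulo D.\<close>

lemma disc_kernel_iff_Gamma0:
  "mat2 p q r s \<in> disc_kernel N D \<longleftrightarrow> mat2 p q r s \<in> Gamma0 N \<and> (\<exists>a d :: int. p = of_int a \<and> s = of_int d \<and>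
     a mod int N \<in> square_trivial_units N D \<and> d mod int N \<in> square_trivial_units N D)"
proof -
  have units: "a mod int N \<in> square_trivial_units N D \<longleftrightarrow> (p\<^sup>2 - 1) / real D \<in> \<int>"
    "d mod int N \<in> square_trivial_units N D \<longleftrightarrow> (s\<^sup>2 - 1) / real D \<in> \<int>"
    if det: "mat2 p q r s \<in> Gamma0 N" "p = of_int a" "s = of_int d" for a d
  proof -
    from det obtain b c where *: "a * d - b * c * int N = 1"
      unfolding Gamma0_iff by (metis of_int_eq_iff)
    have "coprime a (int N)" "coprime d (int N)"
      by (rule coprimeI; metis * dvd_diff dvd_mult dvd_mult2)+
    then show "a mod int N \<in> square_trivial_units N D \<longleftrightarrow> (p\<^sup>2 - 1) / real D \<in> \<int>"
      "d mod int N \<in> square_trivial_units N D \<longleftrightarrow> (s\<^sup>2 - 1) / real D \<in> \<int>"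
      using mod_in_square_trivial_units_iff that by simp_all
  qed
  show ?thesis
  proof
    assume "mat2 p q r s \<in> disc_kernel N D"
    then have L: "level_cond N (Suc 0) p q r s" and c: "q * r / M \<in> \<int>" "r\<^sup>2 / (real N * real D) \<in> \<int>"
      and sq: "(p\<^sup>2 - 1) / real D \<in> \<int>" "(s\<^sup>2 - 1) / real D \<in> \<int>"
      unfolding disc_kernel_iff by blast+
    obtain \<mu> \<nu> :: nat and a b c d :: int where pres:
      "N = \<mu> * \<nu>" "coprime \<mu> \<nu>" "\<mu> > 0" "\<nu> > 0" "assoc_divisor N (mat2 p q r s) = \<mu>"
      "a * d * int \<mu> - b * c * int \<nu> = 1"
      "p = of_int a * sqrt (real \<mu>)" "q = of_int b / sqrt (real \<mu>)"
      "r = of_int c * real \<nu> * sqrt (real \<mu>)" "s = of_int d * sqrt (real \<mu>)"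
      by (rule integral_presentation [OF N_pos L])
    have "coprime \<mu> M" "coprime \<mu> D"
      using c assoc_divisor_conditions(1,2) [OF L] unfolding pres(5) by blast+
    then have "coprime \<mu> N" by (simp add: N_eq)
    then have [simp]: "\<mu> = 1" using pres(1) by (metis coprime_absorb_left dvd_triv_left nat_dvd_1_iff_1)
    have "mat2 p q r s \<in> Gamma0 N"
      unfolding Gamma0_iff using pres
      by (intro exI [of _ a] exI [of _ b] exI [of _ c] exI [of _ d]) auto
    moreover have "p = of_int a" "s = of_int d" using pres by simp_all
    ultimately show "mat2 p q r s \<in> Gamma0 N \<and> (\<exists>a d :: int. p = of_int a \<and> s = of_int d \<and>
       a mod int N \<in> square_trivial_units N D \<and> d mod int N \<in> square_trivial_units N D)"
      using units sq by blast
  next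
    assume "mat2 p q r s \<in> Gamma0 N \<and> (\<exists>a d :: int. p = of_int a \<and> s = of_int d \<and>
     a mod int N \<in> square_trivial_units N D \<and> d mod int N \<in> square_trivial_units N D)"
    then show "mat2 p q r s \<in> disc_kernel N D"
      unfolding disc_kernel_iff using units Gamma0_imp_level_cond_1 by blast
  qed
qed

end

theorem theorem4p2:
  fixes N D :: nat
  assumes "N > 0" and "D dvd N"
  shows
    "SAut_plus (lattice_L N D) = Gamma0_star_sigma N (sigma_level N D)
     \<and>
     (disc_stabilizer N D (disc_H N D) = Gamma0_star N
      \<and> disc_orth N D (disc_H N D) = disc_EF N D
      \<and> disc_stabilizer N D (disc_EF N D) = Gamma0_star N)
     \<and>
     (disc_fixer N D (disc_H N D)
        = {A \<in> Gamma0_star N. coprime (assoc_divisor N A) (N div D)}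
      \<and> Gamma0 N \<subseteq> disc_fixer N D (disc_H N D))
     \<and>
     disc_stabilizer N D (disc_H N D) \<inter> disc_stabilizer N D (disc_E N D)
         \<inter> disc_stabilizer N D (disc_F N D)
       = {A \<in> Gamma0_star N. coprime (assoc_divisor N A) D}
     \<and>
     disc_kernel N D
       = {A \<in> Gamma0 N. \<exists>a d :: int. A $ 1 $ 1 = of_int a \<and> A $ 2 $ 2 = of_int d \<and>
            a mod int N \<in> square_trivial_units N D \<and> d mod int N \<in> square_trivial_units N D}"
proof -
  obtain M where M: "N = D * M" using assms(2) ..
  interpret disc_lattice N D M using M assms(1) by unfold_locales
  have M_eq: "N div D = M" using D_pos by (simp add: M)
  have g: "gcd D (2 * N div D) = gcd D (2 * M)"
    using D_pos by (simp add: M mult.left_commute [of 2])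
  have star: "mat2 p q r s \<in> Gamma0_star N \<longleftrightarrow> level_cond N (Suc 0) p q r s" for p q r s
    using Gamma0_star_sigma_iff [OF assms(1), of 1 p q r s] by (simp add: Gamma0_star_def)
  have i: "SAut_plus L = Gamma0_star_sigma N (sigma_level N D)"
  proof (rule mat2_set_eqI)
    fix p q r s
    show "mat2 p q r s \<in> SAut_plus L \<longleftrightarrow> mat2 p q r s \<in> Gamma0_star_sigma N (sigma_level N D)"
    proof
      assume "mat2 p q r s \<in> SAut_plus L"
      then have "level_cond N (gcd D (2 * M)) p q r s" by (simp add: SAut_plus_iff)
      moreover have "gcd D (2 * M) > 0" using D_pos by simp
      \<comment> \<open>The descent from the gcd to \<open>sigma_level N D\<close>: the matrix only
        has denominator k with k^2 | N, and such a k divides the smaller level too.\<close>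
      ultimately obtain k where "k dvd gcd D (2 * M)" "k\<^sup>2 dvd N"
        "\<And>\<sigma>. k dvd \<sigma> \<Longrightarrow> mat2 p q r s \<in> Gamma0_star_sigma N \<sigma>"
        using level_cond_imp_Gamma0_star_sigma [OF assms(1)] by blast
      then show "mat2 p q r s \<in> Gamma0_star_sigma N (sigma_level N D)"
        using sigma_level_properties(3) [OF assms] g by simp
    next
      assume "mat2 p q r s \<in> Gamma0_star_sigma N (sigma_level N D)"
      then have "level_cond N (sigma_level N D) p q r s"
        by (rule Gamma0_star_sigma_imp_level_cond [OF assms(1)])
      then have "level_cond N (gcd D (2 * M)) p q r s"
        by (rule level_cond_dvd) (use sigma_level_properties(2) [OF assms] g in simp)
      then show "mat2 p q r s \<in> SAut_plus L" by (simp add: SAut_plus_iff)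
    qed
  qed
  have ii: "disc_stabilizer N D (disc_H N D) = Gamma0_star N"
    "disc_stabilizer N D (disc_EF N D) = Gamma0_star N"
    by (rule mat2_set_eqI, simp add: disc_stabilizer_H_iff disc_stabilizer_EF_iff star)+
  have iii: "disc_fixer N D (disc_H N D) = {A \<in> Gamma0_star N. coprime (assoc_divisor N A) (N div D)}"
    by (rule mat2_set_eqI) (use assoc_divisor_conditions(1) in \<open>auto simp: disc_fixer_H_iff star M_eq\<close>)
  have "mat2 p q r s \<in> disc_fixer N D (disc_H N D)" if "mat2 p q r s \<in> Gamma0 N" for p q r s
    using Gamma0_imp_level_cond_1 [OF that] by (simp add: disc_fixer_H_iff)
  then have iii': "Gamma0 N \<subseteq> disc_fixer N D (disc_H N D)"
    by (metis mat2_eta subsetI)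
  have iv: "disc_stabilizer N D (disc_H N D) \<inter> disc_stabilizer N D (disc_E N D)
         \<inter> disc_stabilizer N D (disc_F N D)
       = {A \<in> Gamma0_star N. coprime (assoc_divisor N A) D}"
    by (rule mat2_set_eqI)
      (use assoc_divisor_conditions(2,3) disc_stabilizer_E_iff disc_stabilizer_F_iff in
        \<open>auto simp: disc_stabilizer_H_iff star\<close>)
  have v: "disc_kernel N D
       = {A \<in> Gamma0 N. \<exists>a d :: int. A $ 1 $ 1 = of_int a \<and> A $ 2 $ 2 = of_int d \<and>
            a mod int N \<in> square_trivial_units N D \<and> d mod int N \<in> square_trivial_units N D}"
    by (rule mat2_set_eqI) (simp only: disc_kernel_iff_Gamma0 mem_Collect_eq mat2_nth)
  show ?thesis using i ii disc_orth_disc_H iii iii' iv v by blast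
qed

end
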